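(* If $\kappa$ is the least inaccessible cardinal that is definably Mahlo, then $\kappa$ is second-order sententially categorical and first-order theory categorical, but not first-order sententially categorical.
   Context: A cardinal $\kappa$ is (first-order) definably Mahlo if every closed unbounded set $C\subseteq\kappa$ that is first-order definable in $\langle V_\kappa,\in\rangle$ from parameters in $V_\kappa$ contains a regular cardinal. $V_\kappa$ is the rank-initial segment of the cumulative hierarchy; second-order quantifiers range over all subsets of $V_\kappa$. A cardinal $\kappa$ is sententially (resp. theory) categorical of a given order (first or second) if there is a sentence (resp. theory) $\sigma$ of that order with $\kappa$ inaccessible, $V_\kappa\models\sigma$, and $V_\lambda\not\models\sigma$ for every inaccessible $\lambda\neq\kappa$. *)

theory Defs
  imports "HOL-Library.Equipollence" "HOL-Library.Countable_Set"
begin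

text \<open>
  The ambient universe of sets: a type with an extension map satisfying ZFC, where a set \<open>x\<close> is
  identified with the HOL set \<open>elts x\<close> of its members.
  Separation and Replacement are stated for arbitrary HOL predicates and functions;
  consequently the axiom of choice is inherited from HOL's choice operator, and the HOL subsets
  of \<open>elts x\<close> and the HOL functions from \<open>elts x\<close> to \<open>elts y\<close> are exactly those coded by sets.
  So cardinalities inside the universe may be compared with HOL equipollence.
\<close>

class zfc =
  fixes elts :: "'a \<Rightarrow> 'a set"
  assumes extensionality: "elts x = elts y \<Longrightarrow> x = y"
    and foundation: "elts x \<noteq> {} \<Longrightarrow> \<exists>y\<in>elts x. elts y \<inter> elts x = {}"
    and pairing: "\<exists>z. elts z = {x, y}"
    and union: "\<exists>u. elts u = (\<Union>y\<in>elts x. elts y)"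
    and powerset: "\<exists>p. elts p = {y. elts y \<subseteq> elts x}"
    and infinity: "\<exists>w. (\<exists>e\<in>elts w. elts e = {}) \<and>
                       (\<forall>n\<in>elts w. \<exists>m\<in>elts w. elts m = insert n (elts n))"
    and separation: "\<exists>y. elts y = {z \<in> elts x. P z}"
    and replacement: "\<exists>y. elts y = f ` elts x"

definition transitive_set :: "'v::zfc \<Rightarrow> bool" where
  "transitive_set x \<longleftrightarrow> (\<forall>y\<in>elts x. elts y \<subseteq> elts x)"

definition ordinal :: "'v::zfc \<Rightarrow> bool" where
  "ordinal \<alpha> \<longleftrightarrow> transitive_set \<alpha> \<and> (\<forall>\<beta>\<in>elts \<alpha>. transitive_set \<beta>)"

definition cardinal :: "'v::zfc \<Rightarrow> bool" where
  "cardinal \<kappa> \<longleftrightarrow> ordinal \<kappa> \<and> (\<forall>\<alpha>\<in>elts \<kappa>. \<not> elts \<alpha> \<approx> elts \<kappa>)"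

definition regular_cardinal :: "'v::zfc \<Rightarrow> bool" where
  "regular_cardinal \<kappa> \<longleftrightarrow> cardinal \<kappa> \<and> infinite (elts \<kappa>) \<and>
     (\<forall>A \<subseteq> elts \<kappa>. A \<prec> elts \<kappa> \<longrightarrow> (\<exists>\<beta>\<in>elts \<kappa>. A \<subseteq> elts \<beta>))"

definition strong_limit :: "'v::zfc \<Rightarrow> bool" where
  "strong_limit \<kappa> \<longleftrightarrow> (\<forall>\<alpha>\<in>elts \<kappa>. Pow (elts \<alpha>) \<prec> elts \<kappa>)"

definition inaccessible :: "'v::zfc \<Rightarrow> bool" where
  "inaccessible \<kappa> \<longleftrightarrow> regular_cardinal \<kappa> \<and> uncountable (elts \<kappa>) \<and> strong_limit \<kappa>"

inductive in_Vset :: "'v::zfc \<Rightarrow> 'v \<Rightarrow> bool" where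
  "\<lbrakk>\<beta> \<in> elts \<alpha>; \<And>y. y \<in> elts x \<Longrightarrow> in_Vset y \<beta>\<rbrakk> \<Longrightarrow> in_Vset x \<alpha>"

definition Vset :: "'v::zfc \<Rightarrow> 'v set" where
  "Vset \<alpha> = {x. in_Vset x \<alpha>}"

lemma Vset_rec: "Vset \<alpha> = (\<Union>\<beta>\<in>elts \<alpha>. {x. elts x \<subseteq> Vset \<beta>})"
  unfolding Vset_def by (subst in_Vset.simps) auto

text \<open>
  Variables of either sort are named by natural numbers. \<open>FMem x y\<close> says that the object \<open>x\<close> is a
  member of the object \<open>y\<close>, and \<open>FIn x X\<close> that it belongs to the second-order object \<open>X\<close>.
\<close>

datatype fm =
    FMem nat nat
  | FEq nat nat
  | FIn nat nat
  | FNeg fm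
  | FAnd fm fm
  | FAll nat fm
  | FAll2 nat fm

primrec sat :: "'v::zfc set \<Rightarrow> (nat \<Rightarrow> 'v) \<Rightarrow> (nat \<Rightarrow> 'v set) \<Rightarrow> fm \<Rightarrow> bool" where
  "sat D s S (FMem x y) \<longleftrightarrow> s x \<in> elts (s y)"
| "sat D s S (FEq x y) \<longleftrightarrow> s x = s y"
| "sat D s S (FIn x X) \<longleftrightarrow> s x \<in> S X"
| "sat D s S (FNeg \<phi>) \<longleftrightarrow> \<not> sat D s S \<phi>"
| "sat D s S (FAnd \<phi> \<psi>) \<longleftrightarrow> sat D s S \<phi> \<and> sat D s S \<psi>"
| "sat D s S (FAll x \<phi>) \<longleftrightarrow> (\<forall>a\<in>D. sat D (s(x := a)) S \<phi>)"
| "sat D s S (FAll2 X \<phi>) \<longleftrightarrow> (\<forall>A \<subseteq> D. sat D s (S(X := A)) \<phi>)"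

primrec first_order :: "fm \<Rightarrow> bool" where
  "first_order (FMem x y) \<longleftrightarrow> True"
| "first_order (FEq x y) \<longleftrightarrow> True"
| "first_order (FIn x X) \<longleftrightarrow> False"
| "first_order (FNeg \<phi>) \<longleftrightarrow> first_order \<phi>"
| "first_order (FAnd \<phi> \<psi>) \<longleftrightarrow> first_order \<phi> \<and> first_order \<psi>"
| "first_order (FAll x \<phi>) \<longleftrightarrow> first_order \<phi>"
| "first_order (FAll2 X \<phi>) \<longleftrightarrow> False"

primrec free_vars :: "fm \<Rightarrow> nat set" where
  "free_vars (FMem x y) = {x, y}"
| "free_vars (FEq x y) = {x, y}"
| "free_vars (FIn x X) = {x}"
| "free_vars (FNeg \<phi>) = free_vars \<phi>"
| "free_vars (FAnd \<phi> \<psi>) = free_vars \<phi> \<union> free_vars \<psi>"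
| "free_vars (FAll x \<phi>) = free_vars \<phi> - {x}"
| "free_vars (FAll2 X \<phi>) = free_vars \<phi>"

primrec free_vars2 :: "fm \<Rightarrow> nat set" where
  "free_vars2 (FMem x y) = {}"
| "free_vars2 (FEq x y) = {}"
| "free_vars2 (FIn x X) = {X}"
| "free_vars2 (FNeg \<phi>) = free_vars2 \<phi>"
| "free_vars2 (FAnd \<phi> \<psi>) = free_vars2 \<phi> \<union> free_vars2 \<psi>"
| "free_vars2 (FAll x \<phi>) = free_vars2 \<phi>"
| "free_vars2 (FAll2 X \<phi>) = free_vars2 \<phi> - {X}"

definition second_order_sentences :: "fm set" where
  "second_order_sentences = {\<sigma>. free_vars \<sigma> = {} \<and> free_vars2 \<sigma> = {}}"

definition first_order_sentences :: "fm set" where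
  "first_order_sentences = {\<sigma> \<in> second_order_sentences. first_order \<sigma>}"

definition models :: "'v::zfc set \<Rightarrow> fm \<Rightarrow> bool" where
  "models D \<sigma> \<longleftrightarrow> (\<forall>s S. range s \<subseteq> D \<and> range S \<subseteq> Pow D \<longrightarrow> sat D s S \<sigma>)"

definition unbounded_in :: "'v::zfc set \<Rightarrow> 'v \<Rightarrow> bool" where
  "unbounded_in C \<gamma> \<longleftrightarrow> (\<forall>\<alpha>\<in>elts \<gamma>. \<exists>\<beta>\<in>C \<inter> elts \<gamma>. \<alpha> \<in> elts \<beta>)"

text \<open>
  A nonzero ordinal \<open>\<gamma>\<close> with \<open>unbounded_in C \<gamma>\<close> is automatically a limit ordinal.
\<close>

definition club :: "'v::zfc set \<Rightarrow> 'v \<Rightarrow> bool" where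
  "club C \<kappa> \<longleftrightarrow> C \<subseteq> elts \<kappa> \<and> unbounded_in C \<kappa> \<and>
     (\<forall>\<gamma>\<in>elts \<kappa>. elts \<gamma> \<noteq> {} \<and> unbounded_in C \<gamma> \<longrightarrow> \<gamma> \<in> C)"

text \<open>
  In a defining formula, variable \<open>0\<close> is the argument and the other free variables are
  parameters; second-order variables do not occur, so their assignment is irrelevant.
\<close>

definition first_order_definable :: "'v::zfc set \<Rightarrow> 'v set \<Rightarrow> bool" where
  "first_order_definable D C \<longleftrightarrow>
     (\<exists>\<phi> s. first_order \<phi> \<and> range s \<subseteq> D \<and> C = {a \<in> D. sat D (s(0 := a)) (\<lambda>_. {}) \<phi>})"

definition definably_mahlo :: "'v::zfc \<Rightarrow> bool" where
  "definably_mahlo \<kappa> \<longleftrightarrow> cardinal \<kappa> \<and>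
     (\<forall>C. club C \<kappa> \<and> first_order_definable (Vset \<kappa>) C \<longrightarrow> (\<exists>\<mu>\<in>C. regular_cardinal \<mu>))"

definition sententially_categorical :: "fm set \<Rightarrow> 'v::zfc \<Rightarrow> bool" where
  "sententially_categorical L \<kappa> \<longleftrightarrow> inaccessible \<kappa> \<and>
     (\<exists>\<sigma>\<in>L. models (Vset \<kappa>) \<sigma> \<and>
        (\<forall>\<mu>. inaccessible \<mu> \<and> \<mu> \<noteq> \<kappa> \<longrightarrow> \<not> models (Vset \<mu>) \<sigma>))"

definition theory_categorical :: "fm set \<Rightarrow> 'v::zfc \<Rightarrow> bool" where
  "theory_categorical L \<kappa> \<longleftrightarrow> inaccessible \<kappa> \<and>
     (\<exists>T\<subseteq>L. (\<forall>\<sigma>\<in>T. models (Vset \<kappa>) \<sigma>) \<and>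
        (\<forall>\<mu>. inaccessible \<mu> \<and> \<mu> \<noteq> \<kappa> \<longrightarrow> \<not> (\<forall>\<sigma>\<in>T. models (Vset \<mu>) \<sigma>)))"

end

theory Submission
  imports Defs "HOL-Library.Nat_Bijection"
begin

text \<open>
  That \<open>\<kappa>\<close> is definably Mahlo is a scheme of first-order statements about \<open>V\<^sub>\<kappa>\<close>, and also a single
  second-order statement, since second-order logic can speak of truth predicates. Relativised to a
  rank below, the latter becomes first-order, so ``no inaccessible below is definably Mahlo'' is
  first-order. Together they single out \<open>\<kappa>\<close> among the inaccessible cardinals.

  No first-order sentence \<open>\<sigma>\<close> does: the ordinals closed under Skolem bounds for the subformulas of
  \<open>\<sigma>\<close> and under bounds for cardinal exponentiation form a definable club, and a regular cardinal \<open>\<mu>\<close>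
  in it is inaccessible and reflects \<open>\<sigma>\<close>.
\<close>

subsection \<open>The ambient universe\<close>

text \<open>Everything rests on one closure fact: a subset of V_\<kappa> of size less than \<kappa>
  is an element of V_\<kappa>. Injections between elements of V_\<kappa>, and subsets and power sets
  of elements, therefore lie in V_\<kappa>, so regularity and inaccessibility, which are defined by
  equipollence in HOL, mean the same inside V_\<kappa>. For the same reason second-order quantifiers
  over V_\<mu> with \<mu> below \<kappa> become first-order quantifiers in V_\<kappa>. The gap
  between sentence and theory comes from the quantifier over defining formulas. V_\<kappa> does not
  define its own truth, but a theory can have one axiom per formula, and a class variable can hold a
  satisfaction relation. Conversely, one sentence has finitely many subformulas, so closure under
  its Skolem bounds is again a single first-order condition, to which definable Mahloness applies.
  That property supplies only a regular cardinal; bounds on power sets are built into the club to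
  make it a strong limit, and an infinite ordinal below it makes it uncountable.\<close>

definition is_set :: "'v::zfc set \<Rightarrow> bool" where
  "is_set A \<longleftrightarrow> (\<exists>x. elts x = A)"

definition sset :: "'v::zfc set \<Rightarrow> 'v" where
  "sset A = (SOME x. elts x = A)"

lemma elts_sset: "is_set A \<Longrightarrow> elts (sset A) = A"
  unfolding is_set_def sset_def by (rule someI_ex)

lemma is_set_elts [simp]: "is_set (elts x)"
  unfolding is_set_def by blast

lemma is_set_subset: "is_set A \<Longrightarrow> B \<subseteq> A \<Longrightarrow> is_set B"
proof -
  assume "is_set A" "B \<subseteq> A"
  then obtain x where x: "elts x = A" unfolding is_set_def by blast
  obtain y where "elts y = {z \<in> elts x. z \<in> B}" using separation[of x "\<lambda>z. z \<in> B"] by auto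
  with x \<open>B \<subseteq> A\<close> have "elts y = B" by blast
  then show ?thesis unfolding is_set_def by blast
qed

lemma is_set_image: "is_set A \<Longrightarrow> is_set ((f :: 'v \<Rightarrow> 'v::zfc) ` A)"
  unfolding is_set_def using replacement[of f] by auto

lemma is_set_pair: "is_set {x, y}"
  unfolding is_set_def by (rule pairing)

lemma is_set_UN:
  assumes "is_set A" "\<And>a::'v::zfc. a \<in> A \<Longrightarrow> is_set (B a)"
  shows "is_set (\<Union>a\<in>A. (B a :: 'v set))"
proof -
  have "is_set ((\<lambda>a. sset (B a)) ` A)" using assms(1) by (rule is_set_image)
  then obtain x where x: "elts x = (\<lambda>a. sset (B a)) ` A" unfolding is_set_def by blast
  obtain u where "elts u = (\<Union>y\<in>elts x. elts y)" using union by blast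
  also have "\<dots> = (\<Union>a\<in>A. B a)" using x assms(2) by (simp add: elts_sset)
  finally show ?thesis unfolding is_set_def by blast
qed

lemma is_set_Un: "is_set A \<Longrightarrow> is_set B \<Longrightarrow> is_set (A \<union> B)"
proof -
  assume "is_set A" "is_set B"
  then obtain x y where "elts x = A" "elts y = B" unfolding is_set_def by blast
  then have "A \<union> B = (\<Union>z\<in>{x, y}. elts z)" by simp
  then show ?thesis using is_set_UN[OF is_set_pair[of x y], of elts] by simp
qed

lemma is_set_insert: "is_set A \<Longrightarrow> is_set (insert x A)"
  using is_set_Un[of "{x, x}" A] is_set_pair[of x x] by simp

lemma is_set_Pow: "is_set A \<Longrightarrow> is_set {y. elts y \<subseteq> A}"
  unfolding is_set_def using powerset by metis

lemma inj_on_elts: "inj_on elts A"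
  by (rule inj_onI) (rule extensionality)

text \<open>Separation codes every HOL subset of \<open>elts x\<close>, and codes are unique by
  extensionality. This links \<open>strong_limit\<close>, which uses \<open>Pow\<close>, to the
  power sets that formulas can describe.\<close>

lemma elts_subset_eqpoll_Pow: "{y::'v::zfc. elts y \<subseteq> elts x} \<approx> Pow (elts x)"
proof -
  have "Pow (elts x) \<subseteq> elts ` {y. elts y \<subseteq> elts x}"
  proof
    fix B assume B: "B \<in> Pow (elts x)"
    then have "is_set B" using is_set_subset[OF is_set_elts[of x]] by simp
    then show "B \<in> elts ` {y. elts y \<subseteq> elts x}"
      using elts_sset[of B] B by (intro image_eqI[of _ _ "sset B"]) auto
  qed
  then have "elts ` {y. elts y \<subseteq> elts x} = Pow (elts x)" by auto
  then show ?thesis unfolding eqpoll_def bij_betw_def using inj_on_elts by blast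
qed

lemma mem_irrefl: "x \<notin> elts (x::'v::zfc)"
proof
  assume "x \<in> elts x"
  obtain z where "elts z = {x, x}" using pairing by blast
  with foundation[of z] \<open>x \<in> elts x\<close> show False by auto
qed

definition succ :: "'v::zfc \<Rightarrow> 'v" where
  "succ x = sset (insert x (elts x))"

lemma elts_succ [simp]: "elts (succ x) = insert x (elts x)"
  unfolding succ_def by (simp add: elts_sset is_set_insert)

primrec ordn :: "nat \<Rightarrow> 'v::zfc" where
  "ordn 0 = sset {}"
| "ordn (Suc n) = succ (ordn n)"

lemma elts_sset_empty [simp]: "elts (sset {}) = {}"
  using elts_sset is_set_subset[OF is_set_elts] by blast

lemma elts_ordn: "elts (ordn n) = ordn ` {..<n}"
  by (induction n) (auto simp: lessThan_Suc)

lemma inj_ordn: "inj (ordn :: nat \<Rightarrow> 'v::zfc)"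
proof (rule linorder_inj_onI')
  fix m n :: nat assume "m < n"
  then have "(ordn m :: 'v) \<in> elts (ordn n)" by (simp add: elts_ordn)
  then show "(ordn m :: 'v) \<noteq> ordn n" using mem_irrefl by metis
qed

lemma ordn_eq [simp]: "ordn m = ordn n \<longleftrightarrow> m = n"
  by (rule inj_eq[OF inj_ordn])

lemma is_set_range_ordn: "is_set (range ordn :: 'v::zfc set)"
proof -
  obtain w :: 'v where w: "\<exists>e\<in>elts w. elts e = {}"
    "\<forall>n\<in>elts w. \<exists>m\<in>elts w. elts m = insert n (elts n)"
    using infinity by blast
  have "ordn n \<in> elts w" for n
  proof (induction n)
    case 0
    from w(1) obtain e where "e \<in> elts w" "elts e = {}" by blast
    moreover from this have "e = sset {}" by (intro extensionality) simp
    ultimately show ?case by simp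
  next
    case (Suc n)
    with w(2) obtain m where "m \<in> elts w" "elts m = insert (ordn n) (elts (ordn n))" by blast
    moreover from this have "m = succ (ordn n)" by (intro extensionality) simp
    ultimately show ?case by simp
  qed
  then show ?thesis using is_set_subset[OF is_set_elts[of w]] by blast
qed

text \<open>Replacement along the numerals; it collects the stages of a recursion of length \<omega>
  into one set.\<close>

lemma is_set_countable_range: "is_set (range (g :: nat \<Rightarrow> 'v::zfc))"
proof -
  have "range g = (\<lambda>z. g (inv ordn z)) ` (range ordn :: 'v set)"
    by (simp add: image_image inv_f_f[OF inj_ordn])
  then show ?thesis using is_set_image[OF is_set_range_ordn] by metis
qed

definition omega :: "'v::zfc" where
  "omega = sset (range ordn)"

lemma elts_omega [simp]: "elts omega = range ordn"
  unfolding omega_def by (rule elts_sset[OF is_set_range_ordn])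

lemma transitive_closure_exists:
  "\<exists>t. q \<in> elts t \<and> transitive_set (t::'v::zfc)"
proof -
  \<comment> \<open>\<open>f n\<close> holds what is reached from \<open>q\<close> by
    \<open>n\<close> steps of membership. It is a HOL set, hence the detour through
    \<open>sset\<close> when the stages are united.\<close>
  define f where "f n = ((\<lambda>A. \<Union>y\<in>A. elts y) ^^ n) {q}" for n
  have f0: "f 0 = {q}" and fS: "f (Suc n) = (\<Union>y\<in>f n. elts y)" for n
    by (simp_all add: f_def)
  have set: "is_set (f n)" for n
    using is_set_pair[of q q] by (induction n) (auto simp: f0 fS intro!: is_set_UN)
  have "is_set (\<Union>y\<in>range (\<lambda>n. sset (f n)). elts y)"
    using is_set_UN[OF is_set_countable_range] is_set_elts by blast
  then have "is_set (\<Union>n. f n)" using set by (simp add: elts_sset)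
  then obtain t where t: "elts t = (\<Union>n. f n)" unfolding is_set_def by blast
  have "transitive_set t" unfolding transitive_set_def t using fS by blast
  moreover have "q \<in> elts t" using t f0 by blast
  ultimately show ?thesis by blast
qed

text \<open>The axiom of foundation speaks of sets only. A transitive set around \<open>q\<close>
  cuts the class \<open>Q\<close> down to a set, and minimality survives because the elements of a
  minimal \<open>y\<close> stay in the transitive set.\<close>

lemma wf_elts: "wf {(y, x). y \<in> elts (x::'v::zfc)}"
proof (rule wfI_min)
  fix q :: 'v and Q assume "q \<in> Q"
  obtain t where t: "q \<in> elts t" "transitive_set t" using transitive_closure_exists by blast
  obtain u where u: "elts u = {z \<in> elts t. z \<in> Q}" using separation[of t "\<lambda>z. z \<in> Q"] by auto
  with t \<open>q \<in> Q\<close> have "elts u \<noteq> {}" by blast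
  then obtain y where y: "y \<in> elts u" "elts y \<inter> elts u = {}" using foundation by blast
  have "z \<notin> Q" if "z \<in> elts y" for z
    using that y u t(2) unfolding transitive_set_def by blast
  then show "\<exists>z\<in>Q. \<forall>y. (y, z) \<in> {(y, x). y \<in> elts x} \<longrightarrow> y \<notin> Q" using y(1) u by blast
qed

lemma elts_induct [case_names step]:
  "(\<And>x. (\<And>y. y \<in> elts x \<Longrightarrow> P y) \<Longrightarrow> P x) \<Longrightarrow> P (a::'v::zfc)"
  using wf_induct_rule[OF wf_elts, of P a] by blast

definition upair :: "'v::zfc \<Rightarrow> 'v \<Rightarrow> 'v" where
  "upair x y = sset {x, y}"

definition pair :: "'v::zfc \<Rightarrow> 'v \<Rightarrow> 'v" where
  "pair x y = upair (upair x x) (upair x y)"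

lemma elts_upair [simp]: "elts (upair x y) = {x, y}"
  unfolding upair_def by (rule elts_sset[OF is_set_pair])

lemma eq_upair_iff: "z = upair x y \<longleftrightarrow> elts z = {x, y}"
  using elts_upair extensionality by metis

lemma pair_inject [simp]: "pair x y = pair x' y' \<longleftrightarrow> x = x' \<and> y = y'"
proof
  assume "pair x y = pair x' y'"
  then have "{upair x x, upair x y} = {upair x' x', upair x' y'}"
    unfolding pair_def by (metis elts_upair)
  then show "x = x' \<and> y = y'"
    unfolding doubleton_eq_iff eq_upair_iff elts_upair by auto
qed simp

subsection \<open>Ordinals\<close>

lemma ordinal_mem: "ordinal \<alpha> \<Longrightarrow> \<beta> \<in> elts \<alpha> \<Longrightarrow> ordinal \<beta>"
  unfolding ordinal_def transitive_set_def by blast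

lemma ordinal_mem_subset: "ordinal \<alpha> \<Longrightarrow> \<beta> \<in> elts \<alpha> \<Longrightarrow> elts \<beta> \<subseteq> elts \<alpha>"
  unfolding ordinal_def transitive_set_def by blast

text \<open>Nested \<in>-induction: if \<alpha> and \<beta> were incomparable, every element of
  either would belong to the other, and extensionality would identify them.\<close>

lemma ordinal_trichotomy:
  "ordinal \<alpha> \<Longrightarrow> ordinal \<beta> \<Longrightarrow> \<alpha> \<in> elts \<beta> \<or> \<alpha> = \<beta> \<or> \<beta> \<in> elts (\<alpha>::'v::zfc)"
proof (induction \<alpha> arbitrary: \<beta> rule: elts_induct)
  case (step \<alpha>)
  note IH1 = step.IH and \<alpha> = step.prems(1)
  show ?case using step.prems(2)
  proof (induction \<beta> rule: elts_induct)
    case (step \<beta>)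
    show ?case
    proof (rule ccontr)
      assume neg: "\<not> ?case"
      have "elts \<alpha> \<subseteq> elts \<beta>"
        using IH1 neg \<alpha> step.prems ordinal_mem ordinal_mem_subset by (metis subsetD subsetI)
      moreover have "elts \<beta> \<subseteq> elts \<alpha>"
        using step.IH neg \<alpha> step.prems ordinal_mem ordinal_mem_subset by (metis subsetD subsetI)
      ultimately show False using neg extensionality by blast
    qed
  qed
qed

lemma ordinal_subset_mem:
  "ordinal \<alpha> \<Longrightarrow> ordinal \<beta> \<Longrightarrow> elts \<alpha> \<subseteq> elts \<beta> \<Longrightarrow> \<alpha> = \<beta> \<or> \<alpha> \<in> elts (\<beta>::'v::zfc)"
  using ordinal_trichotomy mem_irrefl by blast

subsection \<open>The cumulative hierarchy\<close>

lemma Vset_iff: "x \<in> Vset \<alpha> \<longleftrightarrow> (\<exists>\<beta>\<in>elts \<alpha>. elts x \<subseteq> Vset \<beta>)"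
  by (subst Vset_rec) auto

lemma Vset_mono: "elts \<alpha> \<subseteq> elts \<beta> \<Longrightarrow> Vset \<alpha> \<subseteq> Vset \<beta>"
  using Vset_iff by blast

lemma Vset_mem_subset:
  "ordinal \<alpha> \<Longrightarrow> x \<in> Vset \<alpha> \<Longrightarrow> elts x \<subseteq> Vset \<alpha>"
  using Vset_iff Vset_mono ordinal_mem_subset by blast

lemma is_set_Vset: "is_set (Vset (\<alpha>::'v::zfc))"
proof (induction \<alpha> rule: elts_induct)
  case (step \<alpha>)
  show ?case by (subst Vset_rec) (auto intro!: is_set_UN is_set_Pow step)
qed

lemma ordinal_in_Vset: "\<alpha> \<in> elts \<nu> \<Longrightarrow> \<alpha> \<in> Vset (\<nu>::'v::zfc)"
proof (induction \<alpha> arbitrary: \<nu> rule: elts_induct)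
  case (step \<alpha>)
  then show ?case using Vset_iff by blast
qed

text \<open>With \<open>ordinal_in_Vset\<close>: the ordinals in V_\<nu> are exactly the elements of
  \<nu>, so formulas can range over \<nu> without naming it.\<close>

lemma ordinal_Vset_mem:
  "ordinal \<nu> \<Longrightarrow> ordinal \<alpha> \<Longrightarrow> \<alpha> \<in> Vset \<nu> \<Longrightarrow> \<alpha> \<in> elts (\<nu>::'v::zfc)"
proof (induction \<alpha> arbitrary: \<nu> rule: elts_induct)
  case (step \<alpha>)
  then obtain \<beta> where b: "\<beta> \<in> elts \<nu>" "elts \<alpha> \<subseteq> Vset \<beta>" using Vset_iff by blast
  then have "elts \<alpha> \<subseteq> elts \<beta>" using step ordinal_mem by blast
  then have "\<alpha> = \<beta> \<or> \<alpha> \<in> elts \<beta>" using b step.prems ordinal_mem ordinal_subset_mem by blast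
  then show ?case using b step.prems ordinal_mem_subset by blast
qed

subsection \<open>Inaccessible ranks\<close>

text \<open>Comparability of cardinals, from the well-orders of HOL. It leaves
  \<open>\<lesssim>\<close> as the only comparison that needs a formula.\<close>

lemma lesspoll_iff_not_lepoll: "A \<prec> B \<longleftrightarrow> \<not> B \<lesssim> A"
proof -
  have "A \<lesssim> B \<or> B \<lesssim> A" unfolding lepoll_def
    unfolding card_of_ordLeq
    using ordLeq_total[OF card_of_Well_order card_of_Well_order] by auto
  then show ?thesis unfolding lesspoll_def using lepoll_antisym eqpoll_imp_lepoll eqpoll_sym by blast
qed

text \<open>An infinite set contains a countable infinite one, strictly smaller if the whole is
  uncountable. This form avoids \<omega> and is easily put into a formula.\<close>

lemma uncountable_iff_lesspoll: "uncountable A \<longleftrightarrow> (\<exists>B\<subseteq>A. infinite B \<and> B \<prec> A)"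
proof
  assume "uncountable A"
  then have "infinite A" using countable_finite by blast
  then obtain B where B: "infinite B" "countable B" "B \<subseteq> A"
    using infinite_countable_subset' by blast
  then have "\<not> A \<lesssim> B" using \<open>uncountable A\<close> countable_lepoll by blast
  then show "\<exists>B\<subseteq>A. infinite B \<and> B \<prec> A" using B by (auto simp: lesspoll_iff_not_lepoll)
next
  assume "\<exists>B\<subseteq>A. infinite B \<and> B \<prec> A"
  then obtain B where B: "B \<subseteq> A" "infinite B" "\<not> A \<lesssim> B" by (auto simp: lesspoll_iff_not_lepoll)
  show "uncountable A"
  proof
    assume "countable A"
    then have "A \<lesssim> (UNIV::nat set)" unfolding lepoll_def countable_def by blast
    moreover have "(UNIV::nat set) \<lesssim> B" using B(2) by (simp add: infinite_le_lepoll)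
    ultimately show False using B(3) lepoll_trans by metis
  qed
qed

locale inaccessible_rank =
  fixes \<kappa> :: "'v::zfc"
  assumes inacc: "inaccessible \<kappa>"
begin

text \<open>Stated for sets over any type, since families of pairs and of assignments also have to
  be counted against \<kappa>.\<close>

abbreviation small :: "'b set \<Rightarrow> bool" where
  "small A \<equiv> A \<prec> elts \<kappa>"

lemma card_kappa: "cardinal \<kappa>" and inf_kappa: "infinite (elts \<kappa>)"
  using inacc unfolding inaccessible_def regular_cardinal_def by auto

lemma ord: "ordinal \<kappa>"
  using card_kappa unfolding cardinal_def by blast

lemma bounded: "A \<subseteq> elts \<kappa> \<Longrightarrow> small A \<Longrightarrow> \<exists>\<beta>\<in>elts \<kappa>. A \<subseteq> elts \<beta>"
  using inacc unfolding inaccessible_def regular_cardinal_def by blast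

lemma mem_trans: "\<alpha> \<in> elts \<beta> \<Longrightarrow> \<beta> \<in> elts \<kappa> \<Longrightarrow> \<alpha> \<in> elts \<kappa>"
  using ord ordinal_mem_subset by blast

lemma small_finite: "finite A \<Longrightarrow> small A"
  using finite_lesspoll_infinite inf_kappa by blast

lemma small_lepoll: "A \<lesssim> B \<Longrightarrow> small B \<Longrightarrow> small A"
  by (rule lesspoll_trans1)

lemma small_subset: "A \<subseteq> B \<Longrightarrow> small B \<Longrightarrow> small A"
  using small_lepoll subset_imp_lepoll by blast

lemma small_image: "small A \<Longrightarrow> small (f ` A)"
  using small_lepoll image_lepoll by blast

lemma small_elts: "\<beta> \<in> elts \<kappa> \<Longrightarrow> small (elts \<beta>)"
  using card_kappa ordinal_mem_subset[OF ord] subset_imp_lepoll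
  unfolding cardinal_def lesspoll_def by blast

text \<open>A small set injects into \<kappa>, and regularity bounds the image. Strong limitness
  speaks of ordinals below \<kappa> only; this carries it over to all small sets.\<close>

lemma small_iff: "small A \<longleftrightarrow> (\<exists>\<beta>\<in>elts \<kappa>. A \<lesssim> elts \<beta>)"
proof
  assume A: "small A"
  then obtain f where f: "inj_on f A" "f ` A \<subseteq> elts \<kappa>" unfolding lesspoll_def lepoll_def by blast
  then obtain \<beta> where "\<beta> \<in> elts \<kappa>" "f ` A \<subseteq> elts \<beta>" using bounded small_image A by metis
  then show "\<exists>\<beta>\<in>elts \<kappa>. A \<lesssim> elts \<beta>" unfolding lepoll_def using f by blast
qed (use small_elts small_lepoll in blast)

lemma small_Pow: "small A \<Longrightarrow> small (Pow A)"
proof -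
  assume "small A"
  then obtain \<beta> where b: "\<beta> \<in> elts \<kappa>" "A \<lesssim> elts \<beta>" using small_iff by blast
  then obtain f where f: "inj_on f A" "f ` A \<subseteq> elts \<beta>" unfolding lepoll_def by blast
  have "inj_on (image f) (Pow A)" using f(1) by (rule inj_on_image_Pow)
  moreover have "image f ` Pow A \<subseteq> Pow (elts \<beta>)" using f(2) by blast
  ultimately have "Pow A \<lesssim> Pow (elts \<beta>)" unfolding lepoll_def by blast
  moreover have "small (Pow (elts \<beta>))"
    using inacc b unfolding inaccessible_def strong_limit_def by blast
  ultimately show ?thesis using small_lepoll by blast
qed

lemma small_countable: "countable A \<Longrightarrow> small A"
  using inacc unfolding inaccessible_def lesspoll_iff_not_lepoll by (blast intro: countable_lepoll)

lemma bounded_fun: "small A \<Longrightarrow> (\<And>a. a \<in> A \<Longrightarrow> f a \<in> elts \<kappa>) \<Longrightarrow> \<exists>\<beta>\<in>elts \<kappa>. \<forall>a\<in>A. f a \<in> elts \<beta>"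
  using bounded[OF _ small_image, of f A] by (simp add: image_subset_iff)

lemma limit: "\<alpha> \<in> elts \<kappa> \<Longrightarrow> \<exists>\<beta>\<in>elts \<kappa>. \<alpha> \<in> elts \<beta>"
  using bounded_fun[of "{()}" "\<lambda>_. \<alpha>"] small_finite by blast

text \<open>Otherwise the sum would map onto \<kappa>. Regularity bounds the map on each fibre and
  then bounds the bounds, so \<kappa> would be included in some \<gamma> below it.\<close>

lemma small_Sigma:
  assumes A: "small A" and B: "\<And>a. a \<in> A \<Longrightarrow> small (B a)"
  shows "small (Sigma A B)"
proof (rule ccontr)
  assume "\<not> small (Sigma A B)"
  then obtain g where g: "elts \<kappa> \<subseteq> g ` Sigma A B"
    unfolding lesspoll_iff_not_lepoll lepoll_iff by blast
  obtain z where z: "z \<in> elts \<kappa>" using inf_kappa by fastforce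
  \<comment> \<open>\<open>g\<close> may take values outside \<kappa>; the default \<open>z\<close>
    keeps them inside.\<close>
  define h where "h p = (if g p \<in> elts \<kappa> then g p else z)" for p
  have h: "h p \<in> elts \<kappa>" for p using z by (simp add: h_def)
  have hs: "elts \<kappa> \<subseteq> h ` Sigma A B" using g unfolding h_def by force
  have "\<exists>\<beta>\<in>elts \<kappa>. \<forall>b\<in>B a. h (a, b) \<in> elts \<beta>" if "a \<in> A" for a
    using bounded_fun[OF B[OF that], of "\<lambda>b. h (a, b)"] h by blast
  then obtain \<beta> where \<beta>: "\<And>a. a \<in> A \<Longrightarrow> \<beta> a \<in> elts \<kappa> \<and> (\<forall>b\<in>B a. h (a, b) \<in> elts (\<beta> a))"
    by metis
  then obtain \<gamma> where \<gamma>: "\<gamma> \<in> elts \<kappa>" "\<And>a. a \<in> A \<Longrightarrow> \<beta> a \<in> elts \<gamma>"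
    using bounded_fun[OF A, of \<beta>] by blast
  have "elts \<kappa> \<subseteq> elts \<gamma>"
  proof
    fix x assume "x \<in> elts \<kappa>"
    then obtain a b where "a \<in> A" "b \<in> B a" "x = h (a, b)" using hs by blast
    then have "x \<in> elts (\<beta> a)" "\<beta> a \<in> elts \<gamma>" using \<beta> \<gamma> by auto
    then show "x \<in> elts \<gamma>" using \<gamma>(1) ordinal_mem[OF ord] ordinal_mem_subset by blast
  qed
  then show False using \<gamma>(1) mem_irrefl by blast
qed

lemma small_UN:
  assumes "small A" and "\<And>a. a \<in> A \<Longrightarrow> small (B a)"
  shows "small (\<Union>a\<in>A. B a)"
proof -
  have "(\<Union>a\<in>A. B a) = snd ` Sigma A B" by force
  then show ?thesis using small_image[OF small_Sigma[OF assms]] by simp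
qed

text \<open>A function is identified with its graph, a subset of a small product. This counts the
  assignments over which Skolem bounds are taken.\<close>

lemma small_funs: "small X \<Longrightarrow> small {f :: nat \<Rightarrow> 'b. range f \<subseteq> X}"
proof -
  assume X: "small X"
  let ?G = "\<lambda>f :: nat \<Rightarrow> 'b. {(n, f n) | n. True}"
  have "inj ?G" unfolding inj_def by fast
  then have "inj_on ?G {f :: nat \<Rightarrow> 'b. range f \<subseteq> X}" by (rule inj_on_subset) simp
  moreover have "?G ` {f :: nat \<Rightarrow> 'b. range f \<subseteq> X} \<subseteq> Pow (UNIV \<times> X)" by blast
  ultimately have "{f :: nat \<Rightarrow> 'b. range f \<subseteq> X} \<lesssim> Pow ((UNIV::nat set) \<times> X)"
    unfolding lepoll_def by (rule exI[of _ ?G, OF conjI])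
  moreover have "small (Pow ((UNIV::nat set) \<times> X))"
    using small_Sigma[of UNIV "\<lambda>_::nat. X"] X small_countable[of "UNIV :: nat set"]
    by (simp add: small_Pow)
  ultimately show ?thesis using small_lepoll by blast
qed

lemma small_elts_subset: "small A \<Longrightarrow> small {x::'v. elts x \<subseteq> A}"
proof -
  assume A: "small A"
  have "inj_on elts {x::'v. elts x \<subseteq> A}" by (rule inj_on_elts)
  moreover have "elts ` {x::'v. elts x \<subseteq> A} \<subseteq> Pow A" by blast
  ultimately have "{x::'v. elts x \<subseteq> A} \<lesssim> Pow A" unfolding lepoll_def by blast
  then show ?thesis using small_lepoll small_Pow[OF A] by blast
qed

lemma small_Vset: "\<alpha> \<in> elts \<kappa> \<Longrightarrow> small (Vset \<alpha>)"
proof (induction \<alpha> rule: elts_induct)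
  case (step \<alpha>)
  have "small {x. elts x \<subseteq> Vset \<beta>}" if "\<beta> \<in> elts \<alpha>" for \<beta>
    using step that mem_trans small_elts_subset by simp
  then show ?case unfolding Vset_rec[of \<alpha>] using step.prems by (intro small_UN small_elts)
qed

section \<open>Closure of V_\<kappa> under small subsets\<close>

abbreviation D :: "'v set" where "D \<equiv> Vset \<kappa>"

lemma D_rank: "x \<in> D \<longleftrightarrow> (\<exists>\<beta>\<in>elts \<kappa>. x \<in> Vset \<beta>)"
proof
  assume "x \<in> D"
  then obtain \<beta> where \<beta>: "\<beta> \<in> elts \<kappa>" "elts x \<subseteq> Vset \<beta>" using Vset_iff by blast
  then obtain \<gamma> where "\<gamma> \<in> elts \<kappa>" "\<beta> \<in> elts \<gamma>" using limit by blast
  then show "\<exists>\<beta>\<in>elts \<kappa>. x \<in> Vset \<beta>" using \<beta> Vset_iff by blast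
next
  assume "\<exists>\<beta>\<in>elts \<kappa>. x \<in> Vset \<beta>"
  then show "x \<in> D" using Vset_mono[OF ordinal_mem_subset[OF ord]] by blast
qed

lemma D_trans: "x \<in> D \<Longrightarrow> y \<in> elts x \<Longrightarrow> y \<in> D"
  using Vset_mem_subset[OF ord] by blast

lemma D_subset: "x \<in> D \<Longrightarrow> elts y \<subseteq> elts x \<Longrightarrow> y \<in> D"
  using Vset_iff by blast

text \<open>The ranks of a small family form a small family of ordinals, which regularity bounds.
  With \<open>is_set_Vset\<close> this makes every small subset of V_\<kappa> an element.\<close>

lemma D_bounded: "A \<subseteq> D \<Longrightarrow> small A \<Longrightarrow> \<exists>\<beta>\<in>elts \<kappa>. A \<subseteq> Vset \<beta>"
proof -
  assume A: "A \<subseteq> D" "small A"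
  then obtain f where f: "\<And>x. x \<in> A \<Longrightarrow> f x \<in> elts \<kappa> \<and> x \<in> Vset (f x)"
    using D_rank by (metis subsetD)
  then obtain \<beta> where \<beta>: "\<beta> \<in> elts \<kappa>" "\<And>x. x \<in> A \<Longrightarrow> f x \<in> elts \<beta>"
    using bounded_fun[OF A(2), of f] by blast
  have "A \<subseteq> Vset \<beta>"
  proof
    fix x assume "x \<in> A"
    then show "x \<in> Vset \<beta>"
      using f \<beta> ordinal_mem[OF ord] ordinal_mem_subset Vset_mono by (metis subsetD)
  qed
  then show ?thesis using \<beta>(1) by blast
qed

lemma D_sset: "A \<subseteq> D \<Longrightarrow> small A \<Longrightarrow> is_set A \<and> sset A \<in> D"
proof -
  assume "A \<subseteq> D" "small A"
  then obtain \<beta> where b: "\<beta> \<in> elts \<kappa>" "A \<subseteq> Vset \<beta>" using D_bounded by blast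
  have "is_set A" using is_set_subset[OF is_set_Vset b(2)] .
  moreover have "sset A \<in> D" unfolding Vset_iff[of _ \<kappa>] using b elts_sset[OF \<open>is_set A\<close>] by auto
  ultimately show ?thesis ..
qed

lemma D_small: "x \<in> D \<Longrightarrow> small (elts x)"
  using Vset_iff small_subset small_Vset by blast

lemma D_code: "A \<subseteq> D \<Longrightarrow> small A \<Longrightarrow> \<exists>x\<in>D. elts x = A"
  using D_sset[of A] elts_sset[of A] by blast

lemma D_upair: "x \<in> D \<Longrightarrow> y \<in> D \<Longrightarrow> upair x y \<in> D"
  unfolding upair_def using D_sset[of "{x, y}"] small_finite[of "{x, y}"] by blast

lemma D_pair: "x \<in> D \<Longrightarrow> y \<in> D \<Longrightarrow> pair x y \<in> D"
  unfolding pair_def by (intro D_upair)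

lemma D_pair_iff: "pair x y \<in> D \<longleftrightarrow> x \<in> D \<and> y \<in> D"
proof
  assume p: "pair x y \<in> D"
  have "upair x y \<in> elts (pair x y)" by (simp add: pair_def)
  then have "upair x y \<in> D" using p D_trans by blast
  then show "x \<in> D \<and> y \<in> D" using D_trans by simp
qed (simp add: D_pair)

lemma D_Pow: "x \<in> D \<Longrightarrow> \<exists>p\<in>D. elts p = {y. elts y \<subseteq> elts x}"
  by (rule D_code) (auto intro: D_subset small_elts_subset D_small)

lemma D_rel:
  "small R \<Longrightarrow> R \<subseteq> D \<times> D \<Longrightarrow> \<exists>r\<in>D. elts r = (\<lambda>(x, y). pair x y) ` R"
  by (rule D_code) (auto simp: D_pair_iff intro: small_image)

lemma D_ord: "\<alpha> \<in> D \<and> ordinal \<alpha> \<longleftrightarrow> \<alpha> \<in> elts \<kappa>"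
  using ordinal_in_Vset ordinal_Vset_mem ordinal_mem ord by blast

lemma D_ordn: "ordn n \<in> D"
proof (induction n)
  case 0 show ?case using D_sset[of "{}"] small_finite[of "{} :: 'v set"] by simp
next
  case (Suc n)
  have "elts (ordn (Suc n)) \<subseteq> D" using Suc D_trans by auto
  moreover have "small (elts (ordn (Suc n)))"
    by (rule small_finite) (simp only: elts_ordn, simp)
  ultimately obtain x where "x \<in> D" "elts x = elts (ordn (Suc n))" using D_code by metis
  then show ?case using extensionality by metis
qed

lemma D_omega: "omega \<in> D"
  unfolding omega_def using D_sset[of "range ordn"] D_ordn small_countable[of "range ordn"] by auto

lemma D_nonempty: "D \<noteq> {}"
  using D_omega by blast

end

subsection \<open>Formulas\<close>

lemma sat_cong:
  "(\<And>x. x \<in> free_vars \<phi> \<Longrightarrow> s x = t x) \<Longrightarrow> (\<And>X. X \<in> free_vars2 \<phi> \<Longrightarrow> S X = T X) \<Longrightarrow>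
    sat D s S \<phi> \<longleftrightarrow> sat D t T \<phi>"
proof (induction \<phi> arbitrary: s t S T)
  case (FAll x \<phi>)
  have "sat D (s(x := a)) S \<phi> \<longleftrightarrow> sat D (t(x := a)) T \<phi>" for a
    by (rule FAll.IH) (use FAll.prems in auto)
  then show ?case by simp
next
  case (FAll2 X \<phi>)
  have "sat D s (S(X := A)) \<phi> \<longleftrightarrow> sat D t (T(X := A)) \<phi>" for A
    by (rule FAll2.IH) (use FAll2.prems in auto)
  then show ?case by simp
next
  case (FAnd \<phi> \<psi>)
  have "sat D s S \<phi> \<longleftrightarrow> sat D t T \<phi>" "sat D s S \<psi> \<longleftrightarrow> sat D t T \<psi>"
    by (rule FAnd.IH; use FAnd.prems in simp)+
  then show ?case by simp
next
  case (FNeg \<phi>)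
  have "sat D s S \<phi> \<longleftrightarrow> sat D t T \<phi>" by (rule FNeg.IH) (use FNeg.prems in auto)
  then show ?case by simp
qed auto

lemma free_vars2_first_order: "first_order \<phi> \<Longrightarrow> free_vars2 \<phi> = {}"
  by (induction \<phi>) auto

lemma sat_first_order: "first_order \<phi> \<Longrightarrow> sat D s S \<phi> \<longleftrightarrow> sat D s T \<phi>"
  by (rule sat_cong) (auto simp: free_vars2_first_order)

lemma finite_free_vars: "finite (free_vars \<phi>)" "finite (free_vars2 \<phi>)"
  by (induction \<phi>) auto

text \<open>Universal closure in both sorts. As \<open>models\<close> quantifies over all
  assignments anyway, formulas with free variables can be used in place of sentences.\<close>

definition sentence_of :: "fm \<Rightarrow> fm" where
  "sentence_of \<phi> = foldr FAll2 (sorted_list_of_set (free_vars2 \<phi>))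
     (foldr FAll (sorted_list_of_set (free_vars \<phi>)) \<phi>)"

lemma free_vars_foldr_FAll:
  "free_vars (foldr FAll xs \<phi>) = free_vars \<phi> - set xs"
  "free_vars2 (foldr FAll xs \<phi>) = free_vars2 \<phi>"
  "first_order (foldr FAll xs \<phi>) \<longleftrightarrow> first_order \<phi>"
  by (induction xs) auto

lemma free_vars_foldr_FAll2:
  "free_vars (foldr FAll2 xs \<phi>) = free_vars \<phi>"
  "free_vars2 (foldr FAll2 xs \<phi>) = free_vars2 \<phi> - set xs"
  by (induction xs) auto

lemma sentence_of_second_order: "sentence_of \<phi> \<in> second_order_sentences"
  unfolding sentence_of_def second_order_sentences_def
  by (simp add: free_vars_foldr_FAll free_vars_foldr_FAll2 finite_free_vars)

lemma sentence_of_first_order: "first_order \<phi> \<Longrightarrow> sentence_of \<phi> \<in> first_order_sentences"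
  using sentence_of_second_order[of \<phi>] unfolding first_order_sentences_def
  by (simp add: sentence_of_def free_vars2_first_order free_vars_foldr_FAll)

lemma models_FAll: "models (D :: 'v::zfc set) (FAll x \<phi>) \<longleftrightarrow> models D \<phi>"
proof
  assume all: "models D (FAll x \<phi>)"
  show "models D \<phi>"
    unfolding models_def
  proof (intro allI impI)
    fix s :: "nat \<Rightarrow> 'v" and S :: "nat \<Rightarrow> 'v set" assume s: "range s \<subseteq> D \<and> range S \<subseteq> Pow D"
    then have "sat D (s(x := s x)) S \<phi>" using all unfolding models_def sat.simps by blast
    then show "sat D s S \<phi>" by simp
  qed
next
  assume "models D \<phi>"
  moreover have "range (s(x := a)) \<subseteq> D" if "range s \<subseteq> D" "a \<in> D"
    for s :: "nat \<Rightarrow> 'v" and a using that by auto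
  ultimately show "models D (FAll x \<phi>)"
    by (simp add: models_def del: fun_upd_apply)
qed

lemma models_FAll2: "models (D :: 'v::zfc set) (FAll2 X \<phi>) \<longleftrightarrow> models D \<phi>"
proof
  assume all: "models D (FAll2 X \<phi>)"
  show "models D \<phi>"
    unfolding models_def
  proof (intro allI impI)
    fix s :: "nat \<Rightarrow> 'v" and S :: "nat \<Rightarrow> 'v set" assume s: "range s \<subseteq> D \<and> range S \<subseteq> Pow D"
    then have "S X \<subseteq> D" by blast
    then have "sat D s (S(X := S X)) \<phi>" using all s unfolding models_def sat.simps by blast
    then show "sat D s S \<phi>" by simp
  qed
next
  assume "models D \<phi>"
  moreover have "range (S(X := A)) \<subseteq> Pow D" if "range S \<subseteq> Pow D" "A \<subseteq> D"
    for S :: "nat \<Rightarrow> 'v set" and A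
    using that by auto
  ultimately show "models D (FAll2 X \<phi>)"
    by (simp add: models_def del: fun_upd_apply)
qed

lemma models_sentence_of: "models D (sentence_of \<phi>) \<longleftrightarrow> models D \<phi>"
proof -
  have "models D (foldr FAll xs \<psi>) \<longleftrightarrow> models D \<psi>" for xs \<psi>
    by (induction xs) (simp_all add: models_FAll)
  moreover have "models D (foldr FAll2 xs \<psi>) \<longleftrightarrow> models D \<psi>" for xs \<psi>
    by (induction xs) (simp_all add: models_FAll2)
  ultimately show ?thesis unfolding sentence_of_def by blast
qed

lemma sat_foldr_FAll:
  "sat D s S (foldr FAll xs \<phi>) \<longleftrightarrow>
    (\<forall>t. (\<forall>x. x \<notin> set xs \<longrightarrow> t x = s x) \<and> (\<forall>x\<in>set xs. t x \<in> D) \<longrightarrow> sat D t S \<phi>)"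
proof (induction xs arbitrary: s)
  case Nil
  have "(\<forall>x. t x = s x) \<longleftrightarrow> t = s" for t by auto
  then show ?case by simp
next
  case (Cons y ys)
  let ?P = "\<lambda>t a. (\<forall>x. x \<notin> set ys \<longrightarrow> t x = (s(y := a)) x) \<and> (\<forall>x\<in>set ys. t x \<in> D)"
  have key: "(\<exists>a\<in>D. ?P t a) \<longleftrightarrow>
    (\<forall>x. x \<notin> set (y # ys) \<longrightarrow> t x = s x) \<and> (\<forall>x\<in>set (y # ys). t x \<in> D)" for t
  proof
    assume r: "(\<forall>x. x \<notin> set (y # ys) \<longrightarrow> t x = s x) \<and> (\<forall>x\<in>set (y # ys). t x \<in> D)"
    \<comment> \<open>The witness \<open>t y\<close> also works when \<open>y\<close> recurs in
      \<open>ys\<close>, where the outer choice is overridden.\<close>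
    have "t x = (s(y := t y)) x" if "x \<notin> set ys" for x
      using that r by (cases "x = y") simp_all
    with r have P: "?P t (t y)" by simp
    from r have "t y \<in> D" by simp
    with P show "\<exists>a\<in>D. ?P t a" by (rule bexI)
  next
    assume "\<exists>a\<in>D. ?P t a"
    then obtain a where a: "a \<in> D" "\<And>x. x \<notin> set ys \<Longrightarrow> t x = (s(y := a)) x" "\<And>x. x \<in> set ys \<Longrightarrow> t x \<in> D"
      by blast
    have "t y \<in> D" using a(1,3) a(2)[of y] by (cases "y \<in> set ys") simp_all
    moreover have "t x = s x" if "x \<notin> set (y # ys)" for x using a(2)[of x] that by simp
    ultimately show "(\<forall>x. x \<notin> set (y # ys) \<longrightarrow> t x = s x) \<and> (\<forall>x\<in>set (y # ys). t x \<in> D)"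
      using a(3) by simp
  qed
  have "sat D s S (foldr FAll (y # ys) \<phi>) \<longleftrightarrow> (\<forall>t. (\<exists>a\<in>D. ?P t a) \<longrightarrow> sat D t S \<phi>)"
    unfolding foldr.simps o_apply sat.simps Cons.IH by blast
  then show ?case unfolding key .
qed

section \<open>Connectives and formulas for set-theoretic notions\<close>

definition FImp :: "fm \<Rightarrow> fm \<Rightarrow> fm" where
  "FImp \<phi> \<psi> = FNeg (FAnd \<phi> (FNeg \<psi>))"

definition FOr :: "fm \<Rightarrow> fm \<Rightarrow> fm" where
  "FOr \<phi> \<psi> = FNeg (FAnd (FNeg \<phi>) (FNeg \<psi>))"

definition FIff :: "fm \<Rightarrow> fm \<Rightarrow> fm" where
  "FIff \<phi> \<psi> = FAnd (FImp \<phi> \<psi>) (FImp \<psi> \<phi>)"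

definition FEx :: "nat \<Rightarrow> fm \<Rightarrow> fm" where
  "FEx x \<phi> = FNeg (FAll x (FNeg \<phi>))"

abbreviation FBall :: "nat \<Rightarrow> nat \<Rightarrow> fm \<Rightarrow> fm" where
  "FBall x y \<phi> \<equiv> FAll x (FImp (FMem x y) \<phi>)"

abbreviation FBex :: "nat \<Rightarrow> nat \<Rightarrow> fm \<Rightarrow> fm" where
  "FBex x y \<phi> \<equiv> FEx x (FAnd (FMem x y) \<phi>)"

lemmas connective_defs = FImp_def FOr_def FIff_def FEx_def

lemma sat_connectives [simp]:
  "sat D s S (FImp \<phi> \<psi>) \<longleftrightarrow> (sat D s S \<phi> \<longrightarrow> sat D s S \<psi>)"
  "sat D s S (FOr \<phi> \<psi>) \<longleftrightarrow> sat D s S \<phi> \<or> sat D s S \<psi>"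
  "sat D s S (FIff \<phi> \<psi>) \<longleftrightarrow> (sat D s S \<phi> \<longleftrightarrow> sat D s S \<psi>)"
  "sat D s S (FEx x \<phi>) \<longleftrightarrow> (\<exists>a\<in>D. sat D (s(x := a)) S \<phi>)"
  by (auto simp: connective_defs)

lemmas sat_simps = sat_connectives sat.simps

text \<open>A bound variable is numbered above the sum of the arguments, hence differs from each of
  them; most formulas that follow use this device.\<close>

definition fm_subset :: "nat \<Rightarrow> nat \<Rightarrow> fm" where
  "fm_subset x y = FBall (Suc (x + y)) x (FMem (Suc (x + y)) y)"

definition fm_empty :: "nat \<Rightarrow> fm" where
  "fm_empty x = FAll (Suc x) (FNeg (FMem (Suc x) x))"

definition fm_upair :: "nat \<Rightarrow> nat \<Rightarrow> nat \<Rightarrow> fm" where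
  "fm_upair z x y = (let u = Suc (x + y + z) in
     FAll u (FIff (FMem u z) (FOr (FEq u x) (FEq u y))))"

definition fm_pair :: "nat \<Rightarrow> nat \<Rightarrow> nat \<Rightarrow> fm" where
  "fm_pair p x y = (let a = Suc (x + y + p); b = Suc a in
     FEx a (FEx b (FAnd (fm_upair a x x) (FAnd (fm_upair b x y) (fm_upair p a b)))))"

definition fm_pair_mem :: "nat \<Rightarrow> nat \<Rightarrow> nat \<Rightarrow> fm" where
  "fm_pair_mem x y r = (let p = Suc (x + y + r) in FBex p r (fm_pair p x y))"

definition fm_pair_in :: "nat \<Rightarrow> nat \<Rightarrow> nat \<Rightarrow> fm" where
  "fm_pair_in x y R = (let p = Suc (x + y) in FEx p (FAnd (FIn p R) (fm_pair p x y)))"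

text \<open>The relation \<open>r\<close> need not be single-valued: it is total on \<open>x\<close>
  and no value belongs to two arguments, so any choice of values is an injection.\<close>

definition fm_lepoll :: "nat \<Rightarrow> nat \<Rightarrow> fm" where
  "fm_lepoll x y = (let r = Suc (x + y); a = Suc r; b = Suc a; c = Suc b in
     FEx r (FAnd (FBall a x (FBex b y (fm_pair_mem a b r)))
       (FBall a x (FBall c x (FAll b
         (FImp (FAnd (fm_pair_mem a b r) (fm_pair_mem c b r)) (FEq a c)))))))"

text \<open>Dedekind infinity, which needs no natural numbers.\<close>

definition fm_infinite :: "nat \<Rightarrow> fm" where
  "fm_infinite x = (let y = Suc x in
     FEx y (FAnd (fm_subset y x) (FAnd (FNeg (FEq y x)) (fm_lepoll x y))))"

definition fm_transitive :: "nat \<Rightarrow> fm" where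
  "fm_transitive x = FBall (Suc x) x (fm_subset (Suc x) x)"

definition fm_ordinal :: "nat \<Rightarrow> fm" where
  "fm_ordinal x = FAnd (fm_transitive x) (FBall (Suc x) x (fm_transitive (Suc x)))"

text \<open>An ordinal includes each of its elements, so by Schroeder-Bernstein equipollence with an
  element is the same as an injection into it.\<close>

definition fm_cardinal :: "nat \<Rightarrow> fm" where
  "fm_cardinal x = FAnd (fm_ordinal x) (FBall (Suc x) x (FNeg (fm_lepoll x (Suc x))))"

definition fm_regular :: "nat \<Rightarrow> fm" where
  "fm_regular x = (let a = Suc x; b = Suc a in
     FAnd (fm_cardinal x) (FAnd (fm_infinite x)
       (FAll a (FImp (FAnd (fm_subset a x) (FNeg (fm_lepoll x a))) (FBex b x (fm_subset a b))))))"

definition fm_powerset :: "nat \<Rightarrow> nat \<Rightarrow> fm" where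
  "fm_powerset p x = (let z = Suc (x + p) in FAll z (FIff (FMem z p) (fm_subset z x)))"

text \<open>The middle conjunct is uncountability in the form of
  \<open>uncountable_iff_lesspoll\<close>.\<close>

definition fm_inaccessible :: "nat \<Rightarrow> fm" where
  "fm_inaccessible x = (let a = Suc x; p = Suc a in
     FAnd (fm_regular x) (FAnd
       (FEx a (FAnd (fm_subset a x) (FAnd (fm_infinite a) (FNeg (fm_lepoll x a)))))
       (FBall a x (FAll p (FImp (fm_powerset p a) (FNeg (fm_lepoll x p)))))))"

text \<open>The witness \<open>r\<close> below is a relation that is closed under the rule defining \<^const>\<open>in_Vset\<close>,
  read backwards; by foundation it consists of pairs in the relation.\<close>

definition fm_in_Vset :: "nat \<Rightarrow> nat \<Rightarrow> fm" where
  "fm_in_Vset x \<alpha> = (let r = Suc (x + \<alpha>); y = Suc r; \<beta> = Suc y; \<gamma> = Suc \<beta>; z = Suc \<gamma> in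
     FEx r (FAnd (fm_pair_mem x \<alpha> r) (FAll y (FAll \<beta> (FImp (fm_pair_mem y \<beta> r)
       (FBex \<gamma> \<beta> (FBall z y (fm_pair_mem z \<gamma> r))))))))"

definition fm_succ :: "nat \<Rightarrow> nat \<Rightarrow> fm" where
  "fm_succ y x = (let z = Suc (x + y) in FAll z (FIff (FMem z y) (FOr (FEq z x) (FMem z x))))"

text \<open>Instead of minimality among inductive sets, every element is required to be empty or a
  successor of an element; foundation then excludes anything but numerals.\<close>

definition fm_omega :: "nat \<Rightarrow> fm" where
  "fm_omega w = (let x = Suc w; y = Suc x in
     FAnd (FBex x w (fm_empty x)) (FAnd (FBall x w (FBex y w (fm_succ y x)))
       (FBall y w (FOr (fm_empty y) (FBex x w (fm_succ y x))))))"

text \<open>Here and below the class variable \<open>0\<close> stands for a class \<open>C\<close> of ordinals.\<close>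

definition fm_club :: fm where
  "fm_club = FAnd (FAll 0 (FImp (FIn 0 0) (fm_ordinal 0)))
     (FAnd (FAll 0 (FImp (fm_ordinal 0) (FEx 1 (FAnd (FIn 1 0) (FMem 0 1)))))
       (FAll 0 (FImp
         (FAnd (fm_ordinal 0) (FAnd (FNeg (fm_empty 0))
           (FBall 1 0 (FBex 2 0 (FAnd (FIn 2 0) (FMem 1 2))))))
         (FIn 0 0))))"

definition fm_club_regular :: fm where
  "fm_club_regular = FImp fm_club (FEx 0 (FAnd (FIn 0 0) (fm_regular 0)))"

lemmas fm_defs = fm_subset_def fm_empty_def fm_upair_def fm_pair_def fm_pair_mem_def
  fm_pair_in_def fm_lepoll_def fm_infinite_def fm_transitive_def fm_ordinal_def fm_cardinal_def
  fm_regular_def fm_powerset_def fm_inaccessible_def fm_in_Vset_def fm_succ_def fm_omega_def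
  fm_club_def fm_club_regular_def Let_def

section \<open>Correctness of the formulas in V_\<kappa>\<close>

context inaccessible_rank
begin

lemma sat_subset: "s x \<in> D \<Longrightarrow> sat D s S (fm_subset x y) \<longleftrightarrow> elts (s x) \<subseteq> elts (s y)"
  unfolding fm_subset_def sat_simps by (auto intro: D_trans)

lemma sat_empty: "s x \<in> D \<Longrightarrow> sat D s S (fm_empty x) \<longleftrightarrow> elts (s x) = {}"
  unfolding fm_empty_def sat_simps by (auto intro: D_trans)

lemma sat_upair:
  "s z \<in> D \<Longrightarrow> s x \<in> D \<Longrightarrow> s y \<in> D \<Longrightarrow> sat D s S (fm_upair z x y) \<longleftrightarrow> s z = upair (s x) (s y)"
  unfolding fm_upair_def Let_def sat_simps eq_upair_iff using D_trans by (simp add: set_eq_iff) blast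

lemma sat_pair:
  "s p \<in> D \<Longrightarrow> s x \<in> D \<Longrightarrow> s y \<in> D \<Longrightarrow> sat D s S (fm_pair p x y) \<longleftrightarrow> s p = pair (s x) (s y)"
  unfolding fm_pair_def Let_def sat_simps by (simp add: sat_upair D_upair pair_def)

lemma sat_pair_mem:
  "s x \<in> D \<Longrightarrow> s y \<in> D \<Longrightarrow> s r \<in> D \<Longrightarrow>
    sat D s S (fm_pair_mem x y r) \<longleftrightarrow> pair (s x) (s y) \<in> elts (s r)"
  unfolding fm_pair_mem_def Let_def sat_simps by (auto simp: sat_pair D_pair)

lemma sat_pair_in:
  "s x \<in> D \<Longrightarrow> s y \<in> D \<Longrightarrow> sat D s S (fm_pair_in x y R) \<longleftrightarrow> pair (s x) (s y) \<in> S R"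
  unfolding fm_pair_in_def Let_def sat_simps by (auto simp: sat_pair D_pair)

text \<open>The graph of an injection between elements of V_\<kappa> is small, so it is coded in
  V_\<kappa>; conversely, choice extracts an injection from \<open>r\<close>.\<close>

lemma lepoll_in_D:
  assumes "x \<in> D" "y \<in> D"
  shows "(\<exists>r\<in>D. (\<forall>a\<in>D. a \<in> elts x \<longrightarrow> (\<exists>b\<in>D. b \<in> elts y \<and> pair a b \<in> elts r)) \<and>
      (\<forall>a\<in>D. a \<in> elts x \<longrightarrow> (\<forall>c\<in>D. c \<in> elts x \<longrightarrow>
        (\<forall>b\<in>D. pair a b \<in> elts r \<and> pair c b \<in> elts r \<longrightarrow> a = c)))) \<longleftrightarrow> elts x \<lesssim> elts y"
    (is "?L \<longleftrightarrow> _")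
proof
  assume ?L
  then obtain r where r:
    "\<forall>a\<in>D. a \<in> elts x \<longrightarrow> (\<exists>b\<in>D. b \<in> elts y \<and> pair a b \<in> elts r)"
    "\<forall>a\<in>D. a \<in> elts x \<longrightarrow> (\<forall>c\<in>D. c \<in> elts x \<longrightarrow>
      (\<forall>b\<in>D. pair a b \<in> elts r \<and> pair c b \<in> elts r \<longrightarrow> a = c))"
    by blast
  have x: "a \<in> D" if "a \<in> elts x" for a using that D_trans assms by blast
  have "\<exists>b. b \<in> D \<and> b \<in> elts y \<and> pair a b \<in> elts r" if "a \<in> elts x" for a
    using r(1) x that by blast
  then obtain f where f: "\<And>a. a \<in> elts x \<Longrightarrow> f a \<in> D \<and> f a \<in> elts y \<and> pair a (f a) \<in> elts r"
    by metis
  have "inj_on f (elts x)" by (rule inj_onI) (metis f r(2) x)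
  then show "elts x \<lesssim> elts y" unfolding lepoll_def using f by blast
next
  assume "elts x \<lesssim> elts y"
  then obtain f where f: "inj_on f (elts x)" "f ` elts x \<subseteq> elts y" unfolding lepoll_def by blast
  let ?R = "(\<lambda>a. (a, f a)) ` elts x"
  have "small ?R" using small_image D_small assms by blast
  moreover have "?R \<subseteq> D \<times> D" using f D_trans assms by blast
  ultimately obtain r where r: "r \<in> D" "elts r = (\<lambda>(x, y). pair x y) ` ?R" using D_rel by blast
  then have "pair a b \<in> elts r \<longleftrightarrow> a \<in> elts x \<and> b = f a" for a b by auto
  moreover have "f a \<in> D" "f a \<in> elts y" if "a \<in> elts x" for a
    using that f D_trans assms by blast+
  ultimately show ?L
    by (intro bexI[OF _ r(1)]) (auto dest: inj_onD[OF f(1)])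
qed

lemma sat_lepoll: "s x \<in> D \<Longrightarrow> s y \<in> D \<Longrightarrow> sat D s S (fm_lepoll x y) \<longleftrightarrow> elts (s x) \<lesssim> elts (s y)"
  unfolding fm_lepoll_def Let_def sat_simps by (simp add: sat_pair_mem flip: lepoll_in_D)

lemma sat_infinite: "s x \<in> D \<Longrightarrow> sat D s S (fm_infinite x) \<longleftrightarrow> infinite (elts (s x))"
proof -
  assume x: "s x \<in> D"
  have "sat D s S (fm_infinite x) \<longleftrightarrow>
    (\<exists>y\<in>D. elts y \<subseteq> elts (s x) \<and> y \<noteq> s x \<and> elts (s x) \<lesssim> elts y)"
    unfolding fm_infinite_def Let_def sat_simps using x by (simp add: sat_subset sat_lepoll)
  also have "\<dots> \<longleftrightarrow> (\<exists>B. B \<subset> elts (s x) \<and> elts (s x) \<lesssim> B)"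
  proof
    assume "\<exists>B. B \<subset> elts (s x) \<and> elts (s x) \<lesssim> B"
    then obtain B where B: "B \<subset> elts (s x)" "elts (s x) \<lesssim> B" by blast
    then obtain y where "y \<in> D" "elts y = B"
      using D_code[of B] D_trans[OF x] small_subset[OF _ D_small[OF x]] by blast
    with B show "\<exists>y\<in>D. elts y \<subseteq> elts (s x) \<and> y \<noteq> s x \<and> elts (s x) \<lesssim> elts y" by blast
  next
    assume "\<exists>y\<in>D. elts y \<subseteq> elts (s x) \<and> y \<noteq> s x \<and> elts (s x) \<lesssim> elts y"
    then obtain y where y: "elts y \<subseteq> elts (s x)" "y \<noteq> s x" "elts (s x) \<lesssim> elts y" by blast
    then have "elts y \<noteq> elts (s x)" using extensionality by metis
    then show "\<exists>B. B \<subset> elts (s x) \<and> elts (s x) \<lesssim> B" using y by blast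
  qed
  finally show ?thesis unfolding infinite_iff_psubset_le .
qed

lemma sat_transitive: "s x \<in> D \<Longrightarrow> sat D s S (fm_transitive x) \<longleftrightarrow> transitive_set (s x)"
  unfolding fm_transitive_def sat_simps transitive_set_def using D_trans by (auto simp: sat_subset)

lemma sat_ordinal: "s x \<in> D \<Longrightarrow> sat D s S (fm_ordinal x) \<longleftrightarrow> ordinal (s x)"
  unfolding fm_ordinal_def sat_simps ordinal_def using D_trans by (auto simp: sat_transitive)

lemma sat_cardinal: "s x \<in> D \<Longrightarrow> sat D s S (fm_cardinal x) \<longleftrightarrow> cardinal (s x)"
proof -
  assume x: "s x \<in> D"
  have "elts \<alpha> \<approx> elts (s x) \<longleftrightarrow> elts (s x) \<lesssim> elts \<alpha>" if "ordinal (s x)" "\<alpha> \<in> elts (s x)" for \<alpha>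
    using subset_imp_lepoll[OF ordinal_mem_subset[OF that]]
    by (metis lepoll_antisym eqpoll_imp_lepoll eqpoll_sym)
  then show ?thesis
    unfolding fm_cardinal_def sat_simps cardinal_def using x D_trans[OF x]
    by (auto simp: sat_ordinal sat_lepoll)
qed

text \<open>Subsets of an element of V_\<kappa> are themselves coded in V_\<kappa>, so the
  quantifier over HOL subsets loses nothing when it is restricted to V_\<kappa>.\<close>

lemma sat_regular: "s x \<in> D \<Longrightarrow> sat D s S (fm_regular x) \<longleftrightarrow> regular_cardinal (s x)"
proof -
  assume x: "s x \<in> D"
  have "sat D s S (fm_regular x) \<longleftrightarrow> cardinal (s x) \<and> infinite (elts (s x)) \<and>
    (\<forall>a\<in>D. elts a \<subseteq> elts (s x) \<and> elts a \<prec> elts (s x) \<longrightarrow>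
      (\<exists>b\<in>D. b \<in> elts (s x) \<and> elts a \<subseteq> elts b))"
    unfolding fm_regular_def Let_def sat_simps using x
    by (simp add: sat_subset sat_lepoll sat_cardinal sat_infinite lesspoll_iff_not_lepoll)
  also have "(\<forall>a\<in>D. elts a \<subseteq> elts (s x) \<and> elts a \<prec> elts (s x) \<longrightarrow>
      (\<exists>b\<in>D. b \<in> elts (s x) \<and> elts a \<subseteq> elts b)) \<longleftrightarrow>
    (\<forall>A \<subseteq> elts (s x). A \<prec> elts (s x) \<longrightarrow> (\<exists>b\<in>elts (s x). A \<subseteq> elts b))" (is "?L \<longleftrightarrow> ?R")
  proof
    assume L: ?L
    show ?R
    proof (intro allI impI)
      fix A assume A: "A \<subseteq> elts (s x)" "A \<prec> elts (s x)"
      then obtain a where "a \<in> D" "elts a = A"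
        using D_code[of A] D_trans[OF x] small_subset[OF _ D_small[OF x]] by blast
      then show "\<exists>b\<in>elts (s x). A \<subseteq> elts b" using L A by blast
    qed
  next
    assume ?R
    then show ?L using D_trans[OF x] by blast
  qed
  finally show ?thesis unfolding regular_cardinal_def .
qed

lemma sat_powerset:
  "s x \<in> D \<Longrightarrow> s p \<in> D \<Longrightarrow> sat D s S (fm_powerset p x) \<longleftrightarrow> elts (s p) = {y. elts y \<subseteq> elts (s x)}"
  unfolding fm_powerset_def Let_def sat_simps
  by (simp add: sat_subset set_eq_iff) (meson D_trans D_subset)

lemma sat_inaccessible: "s x \<in> D \<Longrightarrow> sat D s S (fm_inaccessible x) \<longleftrightarrow> inaccessible (s x)"
proof -
  assume x: "s x \<in> D"
  have "sat D s S (fm_inaccessible x) \<longleftrightarrow> regular_cardinal (s x) \<and>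
    (\<exists>w\<in>D. elts w \<subseteq> elts (s x) \<and> infinite (elts w) \<and> elts w \<prec> elts (s x)) \<and>
    (\<forall>a\<in>D. a \<in> elts (s x) \<longrightarrow>
      (\<forall>p\<in>D. elts p = {y. elts y \<subseteq> elts a} \<longrightarrow> elts p \<prec> elts (s x)))"
    unfolding fm_inaccessible_def Let_def sat_simps using x
    by (simp add: sat_subset sat_lepoll sat_regular sat_infinite sat_powerset
        lesspoll_iff_not_lepoll)
  also have "(\<exists>w\<in>D. elts w \<subseteq> elts (s x) \<and> infinite (elts w) \<and> elts w \<prec> elts (s x)) \<longleftrightarrow>
    uncountable (elts (s x))"
  proof -
    have "\<exists>w\<in>D. elts w = B" if "B \<subseteq> elts (s x)" for B
      using that D_code[of B] D_trans[OF x] small_subset[OF _ D_small[OF x]] by blast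
    then show ?thesis unfolding uncountable_iff_lesspoll by metis
  qed
  also have "(\<forall>a\<in>D. a \<in> elts (s x) \<longrightarrow>
      (\<forall>p\<in>D. elts p = {y. elts y \<subseteq> elts a} \<longrightarrow> elts p \<prec> elts (s x))) \<longleftrightarrow> strong_limit (s x)"
  proof -
    have "{y. elts y \<subseteq> elts a} \<prec> elts (s x) \<longleftrightarrow> Pow (elts a) \<prec> elts (s x)" for a :: 'v
      by (metis eq_lesspoll_trans eqpoll_sym elts_subset_eqpoll_Pow)
    moreover have "(\<forall>p\<in>D. elts p = {y. elts y \<subseteq> elts a} \<longrightarrow> elts p \<prec> elts (s x)) \<longleftrightarrow>
      {y. elts y \<subseteq> elts a} \<prec> elts (s x)" if "a \<in> elts (s x)" for a
      using D_Pow[OF D_trans[OF x that]] by auto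
    ultimately show ?thesis unfolding strong_limit_def using D_trans[OF x] by blast
  qed
  finally show ?thesis unfolding inaccessible_def .
qed

lemma in_Vset_in_D:
  assumes "x \<in> D" "\<alpha> \<in> elts \<kappa>"
  shows "(\<exists>r\<in>D. pair x \<alpha> \<in> elts r \<and> (\<forall>y\<in>D. \<forall>\<beta>\<in>D. pair y \<beta> \<in> elts r \<longrightarrow>
    (\<exists>\<gamma>\<in>D. \<gamma> \<in> elts \<beta> \<and> (\<forall>z\<in>D. z \<in> elts y \<longrightarrow> pair z \<gamma> \<in> elts r)))) \<longleftrightarrow> x \<in> Vset \<alpha>"
    (is "?L \<longleftrightarrow> _")
proof
  assume ?L
  then obtain r where r: "r \<in> D" "pair x \<alpha> \<in> elts r" and
    step: "\<And>y \<beta>. y \<in> D \<Longrightarrow> \<beta> \<in> D \<Longrightarrow> pair y \<beta> \<in> elts r \<Longrightarrow>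
      \<exists>\<gamma>\<in>D. \<gamma> \<in> elts \<beta> \<and> (\<forall>z\<in>D. z \<in> elts y \<longrightarrow> pair z \<gamma> \<in> elts r)"
    by blast
  have "y \<in> D \<Longrightarrow> \<beta> \<in> D \<Longrightarrow> pair y \<beta> \<in> elts r \<Longrightarrow> y \<in> Vset \<beta>" for y \<beta>
  proof (induction y arbitrary: \<beta> rule: elts_induct)
    case (step y)
    then obtain \<gamma> where "\<gamma> \<in> D" "\<gamma> \<in> elts \<beta>" "\<forall>z\<in>D. z \<in> elts y \<longrightarrow> pair z \<gamma> \<in> elts r"
      using \<open>\<And>y \<beta>. \<lbrakk>y \<in> D; \<beta> \<in> D; pair y \<beta> \<in> elts r\<rbrakk> \<Longrightarrow> _ y \<beta>\<close> by blast
    then have "elts y \<subseteq> Vset \<gamma>" using step D_trans by blast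
    then show ?case using Vset_iff \<open>\<gamma> \<in> elts \<beta>\<close> by blast
  qed
  then show "x \<in> Vset \<alpha>" using r assms D_ord by blast
next
  assume x: "x \<in> Vset \<alpha>"
  \<comment> \<open>Cut down to V_\<alpha> and to indices up to \<alpha>, the rank relation becomes
    small, yet it stays closed under the backward rule.\<close>
  let ?R = "{(y, \<beta>). y \<in> Vset \<beta> \<and> y \<in> Vset \<alpha> \<and> \<beta> \<in> elts (succ \<alpha>)}"
  have \<alpha>: "\<alpha> \<in> D" using assms D_ord by blast
  have "small (Vset \<alpha> \<times> elts (succ \<alpha>))"
  proof (rule small_Sigma)
    show "small (elts (succ \<alpha>))"
      using limit[OF assms(2)] small_elts small_subset ordinal_mem_subset[OF ordinal_mem[OF ord]]
      by (metis elts_succ insert_subset)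
  qed (rule small_Vset[OF assms(2)])
  then have "small ?R" by (rule small_subset[rotated]) auto
  moreover have "?R \<subseteq> D \<times> D"
    using Vset_mono[OF ordinal_mem_subset[OF ord assms(2)]] \<alpha> D_trans[OF \<alpha>] by auto
  ultimately obtain r where r: "r \<in> D" "elts r = (\<lambda>(x, y). pair x y) ` ?R" using D_rel by blast
  then have R: "pair y \<beta> \<in> elts r \<longleftrightarrow> y \<in> Vset \<beta> \<and> y \<in> Vset \<alpha> \<and> \<beta> \<in> elts (succ \<alpha>)" for y \<beta>
    by auto
  have "\<exists>\<gamma>\<in>D. \<gamma> \<in> elts \<beta> \<and> (\<forall>z\<in>D. z \<in> elts y \<longrightarrow> pair z \<gamma> \<in> elts r)"
    if "\<beta> \<in> D" "pair y \<beta> \<in> elts r" for y \<beta>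
  proof -
    from that R have y: "y \<in> Vset \<beta>" "y \<in> Vset \<alpha>" "\<beta> = \<alpha> \<or> \<beta> \<in> elts \<alpha>" by auto
    then obtain \<gamma> where \<gamma>: "\<gamma> \<in> elts \<beta>" "elts y \<subseteq> Vset \<gamma>" using Vset_iff by blast
    have ord\<alpha>: "ordinal \<alpha>" using assms(2) ord ordinal_mem by blast
    then have "\<gamma> \<in> elts \<alpha>" using y \<gamma> ordinal_mem_subset by blast
    moreover have "elts y \<subseteq> Vset \<alpha>" using Vset_mem_subset[OF ord\<alpha>] y by blast
    ultimately show ?thesis using \<gamma> R D_trans[OF \<open>\<beta> \<in> D\<close>] by auto
  qed
  moreover have "pair x \<alpha> \<in> elts r" using R x by simp
  ultimately show ?L using r(1) by blast
qed

lemma sat_in_Vset: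
  "s x \<in> D \<Longrightarrow> s \<alpha> \<in> elts \<kappa> \<Longrightarrow> sat D s S (fm_in_Vset x \<alpha>) \<longleftrightarrow> s x \<in> Vset (s \<alpha>)"
  unfolding fm_in_Vset_def Let_def sat_simps using D_ord[of "s \<alpha>"]
  by (simp add: sat_pair_mem in_Vset_in_D)

lemma eq_succ_iff: "y = succ x \<longleftrightarrow> elts y = insert x (elts (x::'v))"
  using elts_succ extensionality by metis

lemma sat_succ: "s x \<in> D \<Longrightarrow> s y \<in> D \<Longrightarrow> sat D s S (fm_succ y x) \<longleftrightarrow> s y = succ (s x)"
  unfolding fm_succ_def Let_def sat_simps eq_succ_iff
  using D_trans[of "s x"] D_trans[of "s y"] by (simp add: set_eq_iff) blast

lemma sat_omega: "s w \<in> D \<Longrightarrow> sat D s S (fm_omega w) \<longleftrightarrow> s w = omega"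
proof -
  assume w: "s w \<in> D"
  have "sat D s S (fm_omega w) \<longleftrightarrow> (\<exists>x\<in>D. x \<in> elts (s w) \<and> elts x = {}) \<and>
    (\<forall>x\<in>D. x \<in> elts (s w) \<longrightarrow> (\<exists>y\<in>D. y \<in> elts (s w) \<and> y = succ x)) \<and>
    (\<forall>y\<in>D. y \<in> elts (s w) \<longrightarrow> elts y = {} \<or> (\<exists>x\<in>D. x \<in> elts (s w) \<and> y = succ x))"
    unfolding fm_omega_def Let_def sat_simps using w
    by (simp add: sat_empty sat_succ)
  also have "\<dots> \<longleftrightarrow> (\<exists>x\<in>elts (s w). elts x = {}) \<and> (\<forall>x\<in>elts (s w). succ x \<in> elts (s w)) \<and>
    (\<forall>y\<in>elts (s w). elts y = {} \<or> (\<exists>x\<in>elts (s w). y = succ x))"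
    using D_trans[OF w] by blast
  also have "\<dots> \<longleftrightarrow> s w = omega" (is "?L \<longleftrightarrow> _")
  proof
    assume L: ?L
    have zero: "x = ordn 0" if "elts x = {}" for x :: 'v
      using that by (intro extensionality) simp
    have "ordn n \<in> elts (s w)" for n
      by (induction n) (use L zero in auto)
    moreover have "y \<in> elts (s w) \<Longrightarrow> y \<in> range ordn" for y
    proof (induction y rule: elts_induct)
      case (step y)
      show ?case
      proof (cases "elts y = {}")
        case True
        then show ?thesis using zero by blast
      next
        case False
        then obtain x where x: "x \<in> elts (s w)" "y = succ x" using L step.prems by blast
        then have "x \<in> range ordn" using step.IH by simp
        then obtain n where "x = ordn n" by blast
        then have "y = ordn (Suc n)" using x by simp
        then show ?thesis by blast
      qed
    qed
    ultimately show "s w = omega" by (intro extensionality) auto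
  next
    assume s: "s w = omega"
    have "elts (ordn 0) = {}" by simp
    moreover have "succ (ordn n) = ordn (Suc n)" for n by simp
    moreover have "elts (ordn n) = {} \<or> (\<exists>m. ordn n = succ (ordn m))" for n by (cases n) auto
    ultimately show ?L unfolding s elts_omega by blast
  qed
  finally show ?thesis .
qed

text \<open>The formula has no name for \<kappa>: its quantifiers over the ordinals of V_\<kappa>
  range over exactly the elements of \<kappa>.\<close>

lemma sat_club: "S 0 \<subseteq> D \<Longrightarrow> sat D s S fm_club \<longleftrightarrow> club (S 0) \<kappa>"
proof -
  assume S: "S 0 \<subseteq> D"
  have "sat D s S fm_club \<longleftrightarrow> (\<forall>a\<in>D. a \<in> S 0 \<longrightarrow> ordinal a) \<and>
    (\<forall>a\<in>D. ordinal a \<longrightarrow> (\<exists>b\<in>D. b \<in> S 0 \<and> a \<in> elts b)) \<and>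
    (\<forall>a\<in>D. ordinal a \<and> elts a \<noteq> {} \<and>
      (\<forall>b\<in>D. b \<in> elts a \<longrightarrow> (\<exists>c\<in>D. c \<in> elts a \<and> c \<in> S 0 \<and> b \<in> elts c)) \<longrightarrow> a \<in> S 0)"
    unfolding fm_club_def sat_simps
    by (simp add: sat_ordinal sat_empty)
  also have "\<dots> \<longleftrightarrow> club (S 0) \<kappa>"
  proof -
    have ord': "a \<in> D \<Longrightarrow> ordinal a \<longleftrightarrow> a \<in> elts \<kappa>" for a using D_ord[of a] by blast
    have trans: "a \<in> elts \<kappa> \<Longrightarrow> b \<in> elts a \<Longrightarrow> b \<in> D" for a b using D_ord D_trans by blast
    have "(\<forall>a\<in>D. a \<in> S 0 \<longrightarrow> ordinal a) \<longleftrightarrow> S 0 \<subseteq> elts \<kappa>"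
      using S ord' D_ord by blast
    moreover have "(\<forall>a\<in>D. ordinal a \<longrightarrow> (\<exists>b\<in>D. b \<in> S 0 \<and> a \<in> elts b)) \<longleftrightarrow> unbounded_in (S 0) \<kappa>"
      if "S 0 \<subseteq> elts \<kappa>"
      unfolding unbounded_in_def using that S D_ord by blast
    moreover have "(\<forall>a\<in>D. ordinal a \<and> elts a \<noteq> {} \<and>
        (\<forall>b\<in>D. b \<in> elts a \<longrightarrow> (\<exists>c\<in>D. c \<in> elts a \<and> c \<in> S 0 \<and> b \<in> elts c)) \<longrightarrow> a \<in> S 0) \<longleftrightarrow>
      (\<forall>\<gamma>\<in>elts \<kappa>. elts \<gamma> \<noteq> {} \<and> unbounded_in (S 0) \<gamma> \<longrightarrow> \<gamma> \<in> S 0)"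
    proof -
      have "(\<forall>b\<in>D. b \<in> elts a \<longrightarrow> (\<exists>c\<in>D. c \<in> elts a \<and> c \<in> S 0 \<and> b \<in> elts c)) \<longleftrightarrow>
          unbounded_in (S 0) a" if "a \<in> elts \<kappa>" for a
        unfolding unbounded_in_def using trans[OF that] by blast
      moreover have "a \<in> D" if "a \<in> elts \<kappa>" for a using that D_ord by blast
      ultimately show ?thesis using ord' by blast
    qed
    ultimately show ?thesis unfolding club_def by blast
  qed
  finally show ?thesis .
qed

lemma sat_club_regular:
  "S 0 \<subseteq> D \<Longrightarrow> sat D s S fm_club_regular \<longleftrightarrow> (club (S 0) \<kappa> \<longrightarrow> (\<exists>\<mu>\<in>S 0. regular_cardinal \<mu>))"
  unfolding fm_club_regular_def sat_simps by (auto simp: sat_club sat_regular)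

end

subsection \<open>Substitution and relativisation\<close>

primrec no_class_quantifier :: "fm \<Rightarrow> bool" where
  "no_class_quantifier (FMem x y) \<longleftrightarrow> True"
| "no_class_quantifier (FEq x y) \<longleftrightarrow> True"
| "no_class_quantifier (FIn x X) \<longleftrightarrow> True"
| "no_class_quantifier (FNeg \<phi>) \<longleftrightarrow> no_class_quantifier \<phi>"
| "no_class_quantifier (FAnd \<phi> \<psi>) \<longleftrightarrow> no_class_quantifier \<phi> \<and> no_class_quantifier \<psi>"
| "no_class_quantifier (FAll x \<phi>) \<longleftrightarrow> no_class_quantifier \<phi>"
| "no_class_quantifier (FAll2 X \<phi>) \<longleftrightarrow> False"

text \<open>\<open>fm_inst n \<phi> \<psi>\<close> replaces membership in any class of \<open>\<psi>\<close> by \<open>\<phi>\<close> with argument \<open>0\<close>. Variables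
  of \<open>\<psi>\<close> are shifted by \<open>n\<close>, which avoids capture when those of \<open>\<phi>\<close> are below \<open>n\<close>.\<close>

primrec fm_inst :: "nat \<Rightarrow> fm \<Rightarrow> fm \<Rightarrow> fm" where
  "fm_inst n \<phi> (FMem x y) = FMem (x + n) (y + n)"
| "fm_inst n \<phi> (FEq x y) = FEq (x + n) (y + n)"
| "fm_inst n \<phi> (FIn x X) = FAll 0 (FImp (FEq 0 (x + n)) \<phi>)"
| "fm_inst n \<phi> (FNeg \<psi>) = FNeg (fm_inst n \<phi> \<psi>)"
| "fm_inst n \<phi> (FAnd \<psi> \<chi>) = FAnd (fm_inst n \<phi> \<psi>) (fm_inst n \<phi> \<chi>)"
| "fm_inst n \<phi> (FAll x \<psi>) = FAll (x + n) (fm_inst n \<phi> \<psi>)"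
| "fm_inst n \<phi> (FAll2 X \<psi>) = fm_inst n \<phi> \<psi>"

lemma first_order_inst: "first_order \<phi> \<Longrightarrow> first_order (fm_inst n \<phi> \<psi>)"
  by (induction \<psi>) (auto simp: connective_defs)

lemma first_order_no_class_quantifier: "first_order \<phi> \<Longrightarrow> no_class_quantifier \<phi>"
  by (induction \<phi>) auto

text \<open>The shifted quantifiers of \<psi> bind variables from \<open>n\<close> on and so leave
  the parameters of \<phi>, all below \<open>n\<close>, alone. Positivity of \<open>n\<close> keeps
  variable \<open>0\<close> free to pass the argument.\<close>

lemma sat_inst:
  assumes n: "0 < n" "free_vars \<phi> \<subseteq> {..<n}"
  shows "no_class_quantifier \<psi> \<Longrightarrow> range s \<subseteq> D \<Longrightarrow>
    sat D s S (fm_inst n \<phi> \<psi>) \<longleftrightarrow>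
    sat D (\<lambda>i. s (i + n)) (\<lambda>_. {a \<in> D. sat D (s(0 := a)) S \<phi>}) \<psi>"
proof (induction \<psi> arbitrary: s)
  case (FIn x X)
  have "s (x + n) \<in> D" using FIn.prems by blast
  then show ?case using n(1) by (auto simp: fun_upd_def)
next
  case (FAll x \<psi>)
  have "sat D (s(x + n := a)) S (fm_inst n \<phi> \<psi>) \<longleftrightarrow>
    sat D ((\<lambda>i. s (i + n))(x := a)) (\<lambda>_. {b \<in> D. sat D (s(0 := b)) S \<phi>}) \<psi>" if a: "a \<in> D" for a
  proof -
    have s: "no_class_quantifier \<psi>" "range (s(x + n := a)) \<subseteq> D" using FAll.prems a by auto
    have shift: "(\<lambda>i. (s(x + n := a)) (i + n)) = (\<lambda>i. s (i + n))(x := a)" by auto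
    have "sat D (s(x + n := a, 0 := b)) S \<phi> \<longleftrightarrow> sat D (s(0 := b)) S \<phi>" for b
      by (rule sat_cong) (use n in auto)
    then show ?thesis using FAll.IH[OF s] by (simp only: shift)
  qed
  then show ?case by (simp only: fm_inst.simps sat.simps cong: ball_cong)
qed auto

text \<open>Relativisation to the set \<open>v\<close> in variable \<open>0\<close>: classes become subsets of \<open>v\<close>, and the variables
  of the two sorts are interleaved.\<close>

primrec fm_rel :: "fm \<Rightarrow> fm" where
  "fm_rel (FMem x y) = FMem (2 * x + 1) (2 * y + 1)"
| "fm_rel (FEq x y) = FEq (2 * x + 1) (2 * y + 1)"
| "fm_rel (FIn x X) = FMem (2 * x + 1) (2 * X + 2)"
| "fm_rel (FNeg \<phi>) = FNeg (fm_rel \<phi>)"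
| "fm_rel (FAnd \<phi> \<psi>) = FAnd (fm_rel \<phi>) (fm_rel \<psi>)"
| "fm_rel (FAll x \<phi>) = FBall (2 * x + 1) 0 (fm_rel \<phi>)"
| "fm_rel (FAll2 X \<phi>) = FAll (2 * X + 2) (FImp (fm_subset (2 * X + 2) 0) (fm_rel \<phi>))"

lemma first_order_rel: "first_order (fm_rel \<phi>)"
  by (induction \<phi>) (auto simp: fm_subset_def connective_defs)

text \<open>Every subset of an element of V_\<kappa> is coded in V_\<kappa>, so class quantifiers
  over that element turn into set quantifiers.\<close>

lemma (in inaccessible_rank) sat_rel:
  "t 0 \<in> D \<Longrightarrow> sat D t S (fm_rel \<phi>) \<longleftrightarrow>
    sat (elts (t 0)) (\<lambda>x. t (2 * x + 1)) (\<lambda>X. elts (t (2 * X + 2))) \<phi>"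
proof (induction \<phi> arbitrary: t)
  have parity [simp]: "Suc (2 * i) \<noteq> 2 * j" "2 * j \<noteq> Suc (2 * i)" for i j :: nat by presburger+
  case (FAll x \<phi>)
  have first: "(\<lambda>y. (t(2 * x + 1 := a)) (2 * y + 1)) = (\<lambda>y. t (2 * y + 1))(x := a)" for a by auto
  have second: "(\<lambda>X. elts ((t(2 * x + 1 := a)) (2 * X + 2))) = (\<lambda>X. elts (t (2 * X + 2)))" for a
    by (rule ext) simp
  have zero: "(t(2 * x + 1 := a)) 0 = t 0" for a by simp
  have "sat D (t(2 * x + 1 := a)) S (fm_rel \<phi>) \<longleftrightarrow>
    sat (elts (t 0)) ((\<lambda>y. t (2 * y + 1))(x := a)) (\<lambda>X. elts (t (2 * X + 2))) \<phi>" for a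
    using FAll.IH[of "t(2 * x + 1 := a)"] FAll.prems by (simp only: first second zero)
  then show ?case using D_trans[OF FAll.prems] by auto
next
  have parity [simp]: "Suc (2 * i) \<noteq> 2 * j" "2 * j \<noteq> Suc (2 * i)" for i j :: nat by presburger+
  case (FAll2 X \<phi>)
  have first: "(\<lambda>x. (t(2 * X + 2 := a)) (2 * x + 1)) = (\<lambda>x. t (2 * x + 1))" for a
    by (rule ext) simp
  have second: "(\<lambda>Y. elts ((t(2 * X + 2 := a)) (2 * Y + 2))) =
    (\<lambda>Y. elts (t (2 * Y + 2)))(X := elts a)" for a
    by (rule ext) simp
  have zero: "(t(2 * X + 2 := a)) 0 = t 0" for a by simp
  have IH: "sat D (t(2 * X + 2 := a)) S (fm_rel \<phi>) \<longleftrightarrow>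
    sat (elts (t 0)) (\<lambda>x. t (2 * x + 1)) ((\<lambda>Y. elts (t (2 * Y + 2)))(X := elts a)) \<phi>" for a
    using FAll2.IH[of "t(2 * X + 2 := a)"] FAll2.prems by (simp only: first second zero)
  have "\<exists>a\<in>D. elts a = A" if "A \<subseteq> elts (t 0)" for A
    using that D_code[of A] D_trans[OF FAll2.prems] small_subset[OF _ D_small[OF FAll2.prems]] by blast
  then show ?case using FAll2.prems by (simp only: fm_rel.simps sat_simps IH) (auto simp: sat_subset)
qed auto

subsection \<open>Definability as a second-order property\<close>

context inaccessible_rank
begin

text \<open>Elements of \<open>s\<close> other than pairs that start with a numeral are ignored, so
  an assignment has many representatives; the truth clauses therefore speak of all of them.\<close>

definition rep :: "'v \<Rightarrow> (nat \<Rightarrow> 'v) \<Rightarrow> bool" where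
  "rep s \<sigma> \<longleftrightarrow> (\<forall>n b. pair (ordn n) b \<in> elts s \<longleftrightarrow> b = \<sigma> n)"

lemma rep_unique: "rep s \<sigma> \<Longrightarrow> rep s \<tau> \<Longrightarrow> \<sigma> = \<tau>"
  unfolding rep_def by blast

lemma rep_range: "s \<in> D \<Longrightarrow> rep s \<sigma> \<Longrightarrow> \<sigma> n \<in> D"
  unfolding rep_def using D_trans D_pair_iff by metis

text \<open>The graph of an assignment is countable, hence small; here uncountability of \<kappa>
  enters the coding.\<close>

lemma rep_exists: 
  assumes "\<And>n. \<sigma> n \<in> D" 
  shows "\<exists>s\<in>D. rep s \<sigma>"
proof -
  have "range (\<lambda>n. (ordn n, \<sigma> n)) \<subseteq> D \<times> D" using assms D_ordn by blast
  moreover have "small (range (\<lambda>n. (ordn n :: 'v, \<sigma> n)))" by (rule small_countable) simp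
  ultimately obtain s where "s \<in> D" "elts s = (\<lambda>(x, y). pair x y) ` range (\<lambda>n. (ordn n, \<sigma> n))"
    using D_rel by metis
  moreover from this have "rep s \<sigma>" unfolding rep_def by auto
  ultimately show ?thesis by blast
qed

end

definition fm_asg :: "nat \<Rightarrow> nat \<Rightarrow> fm" where
  "fm_asg s w = (let x = Suc (s + w); b = Suc x; c = Suc b in
     FBall x w (FEx b (FAnd (fm_pair_mem x b s) (FAll c (FImp (fm_pair_mem x c s) (FEq c b))))))"

definition fm_upd :: "nat \<Rightarrow> nat \<Rightarrow> nat \<Rightarrow> nat \<Rightarrow> nat \<Rightarrow> fm" where
  "fm_upd t s x a w = (let y = Suc (t + s + x + a + w); b = Suc y in
     FBall y w (FAll b (FIff (fm_pair_mem y b t)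
       (FOr (FAnd (FEq y x) (FEq b a)) (FAnd (FNeg (FEq y x)) (fm_pair_mem y b s))))))"

text \<open>A truth predicate needs no coding of syntax: membership in class \<open>1\<close> marks a node, class \<open>2\<close>
  relates nodes to the assignments satisfying them, and the immediate subformulas of a node are nodes
  among its elements. Foundation then lets every node be read as a formula. Variable \<open>0\<close> is \<open>\<omega>\<close>;
  in \<open>fm_node\<close> variable \<open>3\<close> is the node, in \<open>fm_coded\<close> variables \<open>1\<close> and \<open>2\<close> are the node and the
  assignment that define class \<open>0\<close>.\<close>

definition fm_node :: fm where
  "fm_node =
    (let atom = (\<lambda>\<phi>. FBex 6 0 (FBex 7 0 (FAll 8 (FImp (fm_asg 8 0) (FIff (fm_pair_in 3 8 2)
       (FEx 10 (FEx 11 (FAnd (fm_pair_mem 6 10 8) (FAnd (fm_pair_mem 7 11 8) \<phi>)))))))));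
     neg = FBex 4 3 (FAnd (FIn 4 1) (FAll 8 (FImp (fm_asg 8 0)
       (FIff (fm_pair_in 3 8 2) (FNeg (fm_pair_in 4 8 2))))));
     conj = FBex 4 3 (FAnd (FIn 4 1) (FBex 5 3 (FAnd (FIn 5 1) (FAll 8 (FImp (fm_asg 8 0)
       (FIff (fm_pair_in 3 8 2) (FAnd (fm_pair_in 4 8 2) (fm_pair_in 5 8 2))))))));
     all = FBex 4 3 (FAnd (FIn 4 1) (FBex 6 0 (FAll 8 (FImp (fm_asg 8 0)
       (FIff (fm_pair_in 3 8 2) (FAll 10 (FAll 9 (FImp (fm_upd 9 8 6 10 0) (fm_pair_in 4 9 2)))))))))
     in FOr (atom (FMem 10 11)) (FOr (atom (FEq 10 11)) (FOr neg (FOr conj all))))"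

definition fm_coded :: fm where
  "fm_coded = FAnd (fm_omega 0) (FAnd (FAll 3 (FImp (FIn 3 1) fm_node)) (FAnd (FIn 1 1)
     (FAnd (fm_asg 2 0) (FAll 10 (FIff (FIn 10 0)
       (FAll 9 (FImp (FEx 6 (FAnd (fm_empty 6) (fm_upd 9 2 6 10 0))) (fm_pair_in 1 9 2))))))))"

text \<open>The witnesses of definability occur only in the hypothesis, so all their quantifiers can
  be universal and stand in front.\<close>

definition fm_definably_mahlo :: fm where
  "fm_definably_mahlo =
     FAll2 0 (FAll2 1 (FAll2 2 (FAll 0 (FAll 1 (FAll 2 (FImp fm_coded fm_club_regular))))))"

text \<open>The remainder modulo 5 tells the constructor. Subformulas get smaller numbers, so their
  numerals are elements of the node, as \<open>fm_node\<close> demands. The zeros are default values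
  outside the first-order formulas.\<close>

primrec node_number :: "fm \<Rightarrow> nat" where
  "node_number (FMem x y) = 5 * prod_encode (x, y)"
| "node_number (FEq x y) = 5 * prod_encode (x, y) + 1"
| "node_number (FIn x X) = 0"
| "node_number (FNeg \<phi>) = 5 * node_number \<phi> + 2"
| "node_number (FAnd \<phi> \<psi>) = 5 * prod_encode (node_number \<phi>, node_number \<psi>) + 3"
| "node_number (FAll x \<phi>) = 5 * prod_encode (x, node_number \<phi>) + 4"
| "node_number (FAll2 X \<phi>) = 0"

text \<open>Injectivity makes the satisfaction relation on codes well defined.\<close>

lemma node_number_inject:
  "first_order \<phi> \<Longrightarrow> first_order \<psi> \<Longrightarrow> node_number \<phi> = node_number \<psi> \<Longrightarrow> \<phi> = \<psi>"
proof (induction \<phi> arbitrary: \<psi>)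
  case (FMem x y) then show ?case by (cases \<psi>) (auto, presburger+)
next
  case (FEq x y) then show ?case by (cases \<psi>) (auto, presburger+)
next
  case (FNeg \<phi>) then show ?case by (cases \<psi>) (auto, presburger+)
next
  case (FAnd \<phi>1 \<phi>2) then show ?case by (cases \<psi>) (auto, presburger+)
next
  case (FAll x \<phi>) then show ?case by (cases \<psi>) (auto, presburger+)
qed auto

lemma node_number_less:
  "node_number \<phi> < node_number (FNeg \<phi>)"
  "node_number \<phi> < node_number (FAnd \<phi> \<psi>)" "node_number \<psi> < node_number (FAnd \<phi> \<psi>)"
  "node_number \<phi> < node_number (FAll x \<phi>)"
  using le_prod_encode_1[of "node_number \<phi>" "node_number \<psi>"]
    le_prod_encode_2[of "node_number \<psi>" "node_number \<phi>"]
    le_prod_encode_2[of "node_number \<phi>" x]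
  by simp_all

section \<open>Correctness of the truth predicate\<close>

context inaccessible_rank
begin

lemma ball_omega: "(\<forall>x\<in>D. x \<in> range ordn \<longrightarrow> P x) \<longleftrightarrow> (\<forall>n. P (ordn n))"
  using D_ordn by blast

lemma bex_omega: "(\<exists>x\<in>D. x \<in> range ordn \<and> P x) \<longleftrightarrow> (\<exists>n. P (ordn n))"
  using D_ordn by blast

lemma sat_asg:
  assumes "s w = omega" "s x \<in> D"
  shows "sat D s S (fm_asg x w) \<longleftrightarrow> (\<exists>\<sigma>. rep (s x) \<sigma>)"
proof -
  have D: "pair (ordn n) b \<in> elts (s x) \<Longrightarrow> b \<in> D" for n b
    using D_trans[OF assms(2)] D_pair_iff by blast
  have "sat D s S (fm_asg x w) \<longleftrightarrow>
    (\<forall>y\<in>D. y \<in> range ordn \<longrightarrow> (\<exists>b\<in>D. pair y b \<in> elts (s x) \<and>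
      (\<forall>c\<in>D. pair y c \<in> elts (s x) \<longrightarrow> c = b)))"
    unfolding fm_asg_def Let_def sat_simps using assms by (simp add: sat_pair_mem)
  also have "\<dots> \<longleftrightarrow> (\<forall>n. \<exists>b. \<forall>c. pair (ordn n) c \<in> elts (s x) \<longleftrightarrow> c = b)"
    unfolding ball_omega
  proof (rule iff_allI)
    fix n
    show "(\<exists>b\<in>D. pair (ordn n) b \<in> elts (s x) \<and> (\<forall>c\<in>D. pair (ordn n) c \<in> elts (s x) \<longrightarrow> c = b)) \<longleftrightarrow>
      (\<exists>b. \<forall>c. pair (ordn n) c \<in> elts (s x) \<longleftrightarrow> c = b)"
      using D[of n] by blast
  qed
  also have "\<dots> \<longleftrightarrow> (\<exists>\<sigma>. rep (s x) \<sigma>)" unfolding rep_def by (rule choice_iff)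
  finally show ?thesis .
qed

lemma sat_upd:
  assumes "s w = omega" "s t \<in> D" "s r \<in> D" "s a \<in> D" "s x = ordn n" "rep (s r) \<sigma>"
  shows "sat D s S (fm_upd t r x a w) \<longleftrightarrow> rep (s t) (\<sigma>(n := s a))"
proof -
  have D: "pair (ordn m) b \<in> elts (s t) \<Longrightarrow> b \<in> D" for m b
    using D_trans[OF assms(2)] D_pair_iff by blast
  have \<sigma>: "\<sigma> m \<in> D" for m using rep_range assms by blast
  have "sat D s S (fm_upd t r x a w) \<longleftrightarrow>
    (\<forall>y\<in>D. y \<in> range ordn \<longrightarrow> (\<forall>b\<in>D. pair y b \<in> elts (s t) \<longleftrightarrow>
      y = ordn n \<and> b = s a \<or> y \<noteq> ordn n \<and> pair y b \<in> elts (s r)))"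
    unfolding fm_upd_def Let_def sat_simps using assms D_ordn[of n] by (simp add: sat_pair_mem)
  also have "\<dots> \<longleftrightarrow> (\<forall>m. \<forall>b\<in>D. pair (ordn m) b \<in> elts (s t) \<longleftrightarrow> b = (\<sigma>(n := s a)) m)"
    using assms(6) unfolding ball_omega rep_def by auto
  also have "\<dots> \<longleftrightarrow> rep (s t) (\<sigma>(n := s a))"
  proof -
    have "(\<sigma>(n := s a)) m \<in> D" for m using \<sigma> assms(4) by simp
    then show ?thesis unfolding rep_def using D by blast
  qed
  finally show ?thesis .
qed

text \<open>The disjuncts are Tarski's clauses for membership, equality, negation, conjunction and
  universal quantification.\<close>

definition node :: "'v set \<Rightarrow> 'v set \<Rightarrow> 'v \<Rightarrow> bool" where
  "node F T d \<longleftrightarrow>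
    (\<exists>m n. \<forall>s\<in>D. \<forall>\<sigma>. rep s \<sigma> \<longrightarrow> (pair d s \<in> T \<longleftrightarrow> \<sigma> m \<in> elts (\<sigma> n))) \<or>
    (\<exists>m n. \<forall>s\<in>D. \<forall>\<sigma>. rep s \<sigma> \<longrightarrow> (pair d s \<in> T \<longleftrightarrow> \<sigma> m = \<sigma> n)) \<or>
    (\<exists>e\<in>elts d \<inter> F. \<forall>s\<in>D. \<forall>\<sigma>. rep s \<sigma> \<longrightarrow> (pair d s \<in> T \<longleftrightarrow> pair e s \<notin> T)) \<or>
    (\<exists>e\<in>elts d \<inter> F. \<exists>f\<in>elts d \<inter> F. \<forall>s\<in>D. \<forall>\<sigma>. rep s \<sigma> \<longrightarrow>
      (pair d s \<in> T \<longleftrightarrow> pair e s \<in> T \<and> pair f s \<in> T)) \<or>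
    (\<exists>e\<in>elts d \<inter> F. \<exists>n. \<forall>s\<in>D. \<forall>\<sigma>. rep s \<sigma> \<longrightarrow>
      (pair d s \<in> T \<longleftrightarrow> (\<forall>a\<in>D. \<forall>t\<in>D. rep t (\<sigma>(n := a)) \<longrightarrow> pair e t \<in> T)))"

definition coded :: "'v set \<Rightarrow> 'v set \<Rightarrow> 'v set \<Rightarrow> 'v \<Rightarrow> 'v \<Rightarrow> bool" where
  "coded C F T c s \<longleftrightarrow> (\<forall>d\<in>F. node F T d) \<and> c \<in> F \<and> (\<exists>\<sigma>. rep s \<sigma> \<and>
     C = {a \<in> D. \<forall>t\<in>D. rep t (\<sigma>(0 := a)) \<longrightarrow> pair c t \<in> T})"

lemma sat_node:
  assumes s: "s 0 = omega" "s 3 \<in> D"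
  shows "sat D s S fm_node \<longleftrightarrow> node (S 1) (S 2) (s 3)"
proof -
  let ?d = "s 3"
  have ex_elt: "(\<exists>x\<in>D. x \<in> elts ?d \<and> x \<in> S 1 \<and> P x) \<longleftrightarrow> (\<exists>x\<in>elts ?d \<inter> S 1. P x)" for P
    using D_trans[OF s(2)] by blast
  have val: "(\<exists>a\<in>D. \<exists>b\<in>D. pair (ordn m) a \<in> elts r \<and> pair (ordn n) b \<in> elts r \<and> P a b) \<longleftrightarrow>
    P (\<sigma> m) (\<sigma> n)" if "r \<in> D" "rep r \<sigma>" for r \<sigma> m n P
    using that rep_range[OF that] unfolding rep_def by auto
  have all_rep: "(\<forall>r\<in>D. (\<exists>\<sigma>. rep r \<sigma>) \<longrightarrow> P r) \<longleftrightarrow> (\<forall>r\<in>D. \<forall>\<sigma>. rep r \<sigma> \<longrightarrow> Q r \<sigma>)"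
    if "\<And>r \<sigma>. r \<in> D \<Longrightarrow> rep r \<sigma> \<Longrightarrow> P r \<longleftrightarrow> Q r \<sigma>" for P :: "'v \<Rightarrow> bool" and Q
    using that by blast
  have atom: "sat D s S (FBex 6 0 (FBex 7 0 (FAll 8 (FImp (fm_asg 8 0) (FIff (fm_pair_in 3 8 2)
      (FEx 10 (FEx 11 (FAnd (fm_pair_mem 6 10 8) (FAnd (fm_pair_mem 7 11 8) \<phi>))))))))) \<longleftrightarrow>
    (\<exists>m n. \<forall>r\<in>D. \<forall>\<sigma>. rep r \<sigma> \<longrightarrow> (pair ?d r \<in> S 2 \<longleftrightarrow> P (\<sigma> m) (\<sigma> n)))"
    if "\<And>t. sat D t S \<phi> \<longleftrightarrow> P (t 10) (t 11)" for \<phi> P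
  proof -
    have "sat D s S (FBex 6 0 (FBex 7 0 (FAll 8 (FImp (fm_asg 8 0) (FIff (fm_pair_in 3 8 2)
      (FEx 10 (FEx 11 (FAnd (fm_pair_mem 6 10 8) (FAnd (fm_pair_mem 7 11 8) \<phi>))))))))) \<longleftrightarrow>
      (\<exists>x\<in>D. x \<in> range ordn \<and> (\<exists>y\<in>D. y \<in> range ordn \<and>
        (\<forall>r\<in>D. (\<exists>\<sigma>. rep r \<sigma>) \<longrightarrow> (pair ?d r \<in> S 2 \<longleftrightarrow>
          (\<exists>a\<in>D. \<exists>b\<in>D. pair x a \<in> elts r \<and> pair y b \<in> elts r \<and> P a b)))))"
      unfolding sat_simps that using s
      by (simp add: sat_asg sat_pair_in sat_pair_mem)
    also have "\<dots> \<longleftrightarrow> (\<exists>m n. \<forall>r\<in>D. (\<exists>\<sigma>. rep r \<sigma>) \<longrightarrow> (pair ?d r \<in> S 2 \<longleftrightarrow>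
        (\<exists>a\<in>D. \<exists>b\<in>D. pair (ordn m) a \<in> elts r \<and> pair (ordn n) b \<in> elts r \<and> P a b)))"
      unfolding bex_omega ..
    also have "\<dots> \<longleftrightarrow> (\<exists>m n. \<forall>r\<in>D. \<forall>\<sigma>. rep r \<sigma> \<longrightarrow> (pair ?d r \<in> S 2 \<longleftrightarrow> P (\<sigma> m) (\<sigma> n)))"
      by (intro ex_cong1 all_rep) (simp only: val)
    finally show ?thesis .
  qed
  have all: "sat D s S (FBex 4 3 (FAnd (FIn 4 1) (FBex 6 0 (FAll 8 (FImp (fm_asg 8 0)
       (FIff (fm_pair_in 3 8 2)
         (FAll 10 (FAll 9 (FImp (fm_upd 9 8 6 10 0) (fm_pair_in 4 9 2)))))))))) \<longleftrightarrow>
    (\<exists>e\<in>elts ?d \<inter> S 1. \<exists>n. \<forall>r\<in>D. \<forall>\<sigma>. rep r \<sigma> \<longrightarrow>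
      (pair ?d r \<in> S 2 \<longleftrightarrow> (\<forall>a\<in>D. \<forall>t\<in>D. rep t (\<sigma>(n := a)) \<longrightarrow> pair e t \<in> S 2)))" (is "?l \<longleftrightarrow> ?r")
  proof -
    have "?l \<longleftrightarrow> (\<exists>e\<in>D. e \<in> elts ?d \<and> e \<in> S 1 \<and> (\<exists>x\<in>D. x \<in> range ordn \<and>
      (\<forall>r\<in>D. (\<exists>\<sigma>. rep r \<sigma>) \<longrightarrow> (pair ?d r \<in> S 2 \<longleftrightarrow>
        (\<forall>a\<in>D. \<forall>t\<in>D. sat D (s(4 := e, 6 := x, 8 := r, 10 := a, 9 := t)) S (fm_upd 9 8 6 10 0) \<longrightarrow>
          pair e t \<in> S 2)))))"
      unfolding sat_simps using s
      by (simp add: sat_asg sat_pair_in)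
    also have "\<dots> \<longleftrightarrow> ?r"
      unfolding ex_elt bex_omega using s D_ordn
      by (intro ex_cong1 bex_cong refl all_rep) (simp add: sat_upd)
    finally show ?thesis .
  qed
  have neg: "sat D s S (FBex 4 3 (FAnd (FIn 4 1) (FAll 8 (FImp (fm_asg 8 0)
       (FIff (fm_pair_in 3 8 2) (FNeg (fm_pair_in 4 8 2))))))) \<longleftrightarrow>
    (\<exists>e\<in>elts ?d \<inter> S 1. \<forall>r\<in>D. \<forall>\<sigma>. rep r \<sigma> \<longrightarrow> (pair ?d r \<in> S 2 \<longleftrightarrow> pair e r \<notin> S 2))"
    (is "?l \<longleftrightarrow> ?r")
  proof -
    have "?l \<longleftrightarrow> (\<exists>e\<in>D. e \<in> elts ?d \<and> e \<in> S 1 \<and>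
      (\<forall>r\<in>D. (\<exists>\<sigma>. rep r \<sigma>) \<longrightarrow> (pair ?d r \<in> S 2 \<longleftrightarrow> pair e r \<notin> S 2)))"
      unfolding sat_simps using s
      by (simp add: sat_asg sat_pair_in)
    also have "\<dots> \<longleftrightarrow> ?r" unfolding ex_elt by blast
    finally show ?thesis .
  qed
  have conj: "sat D s S (FBex 4 3 (FAnd (FIn 4 1) (FBex 5 3 (FAnd (FIn 5 1)
       (FAll 8 (FImp (fm_asg 8 0)
         (FIff (fm_pair_in 3 8 2) (FAnd (fm_pair_in 4 8 2) (fm_pair_in 5 8 2))))))))) \<longleftrightarrow>
    (\<exists>e\<in>elts ?d \<inter> S 1. \<exists>f\<in>elts ?d \<inter> S 1. \<forall>r\<in>D. \<forall>\<sigma>. rep r \<sigma> \<longrightarrow>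
      (pair ?d r \<in> S 2 \<longleftrightarrow> pair e r \<in> S 2 \<and> pair f r \<in> S 2))" (is "?l \<longleftrightarrow> ?r")
  proof -
    have "?l \<longleftrightarrow> (\<exists>e\<in>D. e \<in> elts ?d \<and> e \<in> S 1 \<and> (\<exists>f\<in>D. f \<in> elts ?d \<and> f \<in> S 1 \<and>
      (\<forall>r\<in>D. (\<exists>\<sigma>. rep r \<sigma>) \<longrightarrow> (pair ?d r \<in> S 2 \<longleftrightarrow> pair e r \<in> S 2 \<and> pair f r \<in> S 2))))"
      unfolding sat_simps using s
      by (simp add: sat_asg sat_pair_in)
    also have "\<dots> \<longleftrightarrow> ?r" unfolding ex_elt by blast
    finally show ?thesis .
  qed
  show ?thesis
    unfolding fm_node_def Let_def sat_connectives(2) 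
      atom[of "FMem 10 11" "\<lambda>a b. a \<in> elts b", OF sat.simps(1)]
      atom[of "FEq 10 11" "(=)", OF sat.simps(2)] neg conj all
      node_def ..
qed

lemma sat_coded:
  assumes s: "s 1 \<in> D" "s 2 \<in> D" and S: "S 0 \<subseteq> D" "S 1 \<subseteq> D" "s 0 \<in> D"
  shows "sat D s S fm_coded \<longleftrightarrow> s 0 = omega \<and> coded (S 0) (S 1) (S 2) (s 1) (s 2)"
proof (cases "s 0 = omega")
  case False
  then show ?thesis using S by (simp add: fm_coded_def sat_omega)
next
  case True
  \<comment> \<open>The argument sits at index \<open>0\<close>, whose numeral is the empty set; the
    formula describes it by \<open>fm_empty\<close>.\<close>
  have upd: "(\<exists>z\<in>D. elts z = {} \<and> sat D (s(10 := a, 9 := t, 6 := z)) S (fm_upd 9 2 6 10 0)) \<longleftrightarrow>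
    rep t (\<sigma>(0 := a))" if "a \<in> D" "t \<in> D" "rep (s 2) \<sigma>" for a t \<sigma>
  proof -
    have "elts z = {} \<longleftrightarrow> z = ordn 0" for z :: 'v
      using extensionality[of z "ordn 0"] by auto
    then show ?thesis using that True s D_ordn[of 0] by (simp add: sat_upd[where \<sigma> = \<sigma> and n = 0])
  qed
  have "sat D s S fm_coded \<longleftrightarrow> (\<forall>d\<in>D. d \<in> S 1 \<longrightarrow> node (S 1) (S 2) d) \<and> s 1 \<in> S 1 \<and>
    (\<exists>\<sigma>. rep (s 2) \<sigma>) \<and> (\<forall>a\<in>D. a \<in> S 0 \<longleftrightarrow> (\<forall>t\<in>D.
      (\<exists>z\<in>D. elts z = {} \<and> sat D (s(10 := a, 9 := t, 6 := z)) S (fm_upd 9 2 6 10 0)) \<longrightarrow>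
        pair (s 1) t \<in> S 2))"
    unfolding fm_coded_def sat_simps using s True D_omega
    by (simp add: sat_omega sat_node sat_asg sat_empty sat_pair_in)
  also have "\<dots> \<longleftrightarrow> (\<forall>d\<in>S 1. node (S 1) (S 2) d) \<and> s 1 \<in> S 1 \<and>
    (\<exists>\<sigma>. rep (s 2) \<sigma> \<and> (\<forall>a\<in>D. a \<in> S 0 \<longleftrightarrow>
      (\<forall>t\<in>D. rep t (\<sigma>(0 := a)) \<longrightarrow> pair (s 1) t \<in> S 2)))"
  proof -
    have "(\<forall>a\<in>D. a \<in> S 0 \<longleftrightarrow> (\<forall>t\<in>D.
        (\<exists>z\<in>D. elts z = {} \<and> sat D (s(10 := a, 9 := t, 6 := z)) S (fm_upd 9 2 6 10 0)) \<longrightarrow>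
          pair (s 1) t \<in> S 2)) \<longleftrightarrow>
      (\<forall>a\<in>D. a \<in> S 0 \<longleftrightarrow> (\<forall>t\<in>D. rep t (\<sigma>(0 := a)) \<longrightarrow> pair (s 1) t \<in> S 2))"
      if "rep (s 2) \<sigma>" for \<sigma>
      using upd[OF _ _ that] by (simp del: fun_upd_apply cong: ball_cong)
    moreover have "(\<forall>d\<in>D. d \<in> S 1 \<longrightarrow> node (S 1) (S 2) d) \<longleftrightarrow> (\<forall>d\<in>S 1. node (S 1) (S 2) d)"
      using S(2) by blast
    ultimately show ?thesis by blast
  qed
  also have "\<dots> \<longleftrightarrow> coded (S 0) (S 1) (S 2) (s 1) (s 2)"
  proof -
    have "(\<forall>a\<in>D. a \<in> S 0 \<longleftrightarrow> P a) \<longleftrightarrow> S 0 = {a \<in> D. P a}" for P using S(1) by blast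
    then show ?thesis unfolding coded_def by simp
  qed
  finally show ?thesis using True by simp
qed

text \<open>By \<in>-induction each node is read as a formula, built from formulas for nodes among
  its elements. Several clauses may hold of one node; any of them will do.\<close>

lemma coded_imp_definable:
  assumes "coded C F T c s" "s \<in> D"
  shows "first_order_definable D C"
proof -
  obtain \<sigma> where node: "\<And>d. d \<in> F \<Longrightarrow> node F T d" and c: "c \<in> F" and \<sigma>: "rep s \<sigma>"
    and C: "C = {a \<in> D. \<forall>t\<in>D. rep t (\<sigma>(0 := a)) \<longrightarrow> pair c t \<in> T}"
    using assms(1) unfolding coded_def by blast
  have *: "d \<in> F \<Longrightarrow> \<exists>\<phi>. first_order \<phi> \<and>
    (\<forall>s\<in>D. \<forall>\<sigma>. rep s \<sigma> \<longrightarrow> (pair d s \<in> T \<longleftrightarrow> sat D \<sigma> (\<lambda>_. {}) \<phi>))" for d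
  proof (induction d rule: elts_induct)
    case (step d)
    from node[OF step.prems] consider
      (mem) m n where "\<forall>s\<in>D. \<forall>\<sigma>. rep s \<sigma> \<longrightarrow> (pair d s \<in> T \<longleftrightarrow> \<sigma> m \<in> elts (\<sigma> n))"
    | (eq) m n where "\<forall>s\<in>D. \<forall>\<sigma>. rep s \<sigma> \<longrightarrow> (pair d s \<in> T \<longleftrightarrow> \<sigma> m = \<sigma> n)"
    | (neg) e where "e \<in> elts d \<inter> F" "\<forall>s\<in>D. \<forall>\<sigma>. rep s \<sigma> \<longrightarrow> (pair d s \<in> T \<longleftrightarrow> pair e s \<notin> T)"
    | (conj) e f where "e \<in> elts d \<inter> F" "f \<in> elts d \<inter> F"
        "\<forall>s\<in>D. \<forall>\<sigma>. rep s \<sigma> \<longrightarrow> (pair d s \<in> T \<longleftrightarrow> pair e s \<in> T \<and> pair f s \<in> T)"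
    | (all) e n where "e \<in> elts d \<inter> F" "\<forall>s\<in>D. \<forall>\<sigma>. rep s \<sigma> \<longrightarrow>
        (pair d s \<in> T \<longleftrightarrow> (\<forall>a\<in>D. \<forall>t\<in>D. rep t (\<sigma>(n := a)) \<longrightarrow> pair e t \<in> T))"
      unfolding node_def by blast
    then show ?case
    proof cases
      case mem
      then show ?thesis by (intro exI[of _ "FMem m n"]) simp
    next
      case eq
      then show ?thesis by (intro exI[of _ "FEq m n"]) simp
    next
      case neg
      then obtain \<phi> where "first_order \<phi>"
        "\<forall>s\<in>D. \<forall>\<sigma>. rep s \<sigma> \<longrightarrow> (pair e s \<in> T \<longleftrightarrow> sat D \<sigma> (\<lambda>_. {}) \<phi>)"
        using step.IH[of e] by blast
      then show ?thesis using neg by (intro exI[of _ "FNeg \<phi>"]) simp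
    next
      case conj
      then obtain \<phi> \<psi> where "first_order \<phi>" "first_order \<psi>"
        "\<forall>s\<in>D. \<forall>\<sigma>. rep s \<sigma> \<longrightarrow> (pair e s \<in> T \<longleftrightarrow> sat D \<sigma> (\<lambda>_. {}) \<phi>)"
        "\<forall>s\<in>D. \<forall>\<sigma>. rep s \<sigma> \<longrightarrow> (pair f s \<in> T \<longleftrightarrow> sat D \<sigma> (\<lambda>_. {}) \<psi>)"
        using step.IH[of e] step.IH[of f] by blast
      then show ?thesis using conj by (intro exI[of _ "FAnd \<phi> \<psi>"]) simp
    next
      case all
      then obtain \<phi> where \<phi>: "first_order \<phi>"
        "\<forall>s\<in>D. \<forall>\<sigma>. rep s \<sigma> \<longrightarrow> (pair e s \<in> T \<longleftrightarrow> sat D \<sigma> (\<lambda>_. {}) \<phi>)"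
        using step.IH[of e] by blast
      have "(\<forall>a\<in>D. \<forall>t\<in>D. rep t (\<sigma>(n := a)) \<longrightarrow> pair e t \<in> T) \<longleftrightarrow>
        (\<forall>a\<in>D. sat D (\<sigma>(n := a)) (\<lambda>_. {}) \<phi>)" if "s \<in> D" "rep s \<sigma>" for s \<sigma>
      proof (rule ball_cong[OF refl])
        fix a assume a: "a \<in> D"
        \<comment> \<open>The updated assignment has a representative, so the quantifier over
          representatives is not vacuous.\<close>
        have "(\<sigma>(n := a)) m \<in> D" for m using rep_range[OF that] a by simp
        then obtain t where "t \<in> D" "rep t (\<sigma>(n := a))" using rep_exists by blast
        then show "(\<forall>t\<in>D. rep t (\<sigma>(n := a)) \<longrightarrow> pair e t \<in> T) \<longleftrightarrow> sat D (\<sigma>(n := a)) (\<lambda>_. {}) \<phi>"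
          using \<phi>(2) by blast
      qed
      then show ?thesis using all(2) \<phi>(1) by (intro exI[of _ "FAll n \<phi>"]) simp
    qed
  qed
  obtain \<phi> where \<phi>: "first_order \<phi>"
    "\<forall>s\<in>D. \<forall>\<sigma>. rep s \<sigma> \<longrightarrow> (pair c s \<in> T \<longleftrightarrow> sat D \<sigma> (\<lambda>_. {}) \<phi>)"
    using *[OF c] by blast
  have "(\<forall>t\<in>D. rep t (\<sigma>(0 := a)) \<longrightarrow> pair c t \<in> T) \<longleftrightarrow> sat D (\<sigma>(0 := a)) (\<lambda>_. {}) \<phi>"
    if a: "a \<in> D" for a
  proof -
    have "(\<sigma>(0 := a)) m \<in> D" for m using rep_range[OF assms(2) \<sigma>] a by simp
    then obtain t where "t \<in> D" "rep t (\<sigma>(0 := a))" using rep_exists by blast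
    then show ?thesis using \<phi>(2) by blast
  qed
  then have "C = {a \<in> D. sat D (\<sigma>(0 := a)) (\<lambda>_. {}) \<phi>}" unfolding C by blast
  moreover have "range \<sigma> \<subseteq> D" using rep_range[OF assms(2) \<sigma>] by blast
  ultimately show ?thesis unfolding first_order_definable_def using \<phi>(1) by blast
qed

text \<open>The numerals coding all first-order formulas serve as nodes, and actual satisfaction in
  V_\<kappa> as the truth class.\<close>

lemma definable_imp_coded:
  assumes "first_order_definable D C"
  shows "\<exists>F\<subseteq>D. \<exists>T\<subseteq>D. \<exists>c\<in>D. \<exists>s\<in>D. coded C F T c s"
proof -
  obtain \<phi> \<sigma> where \<phi>: "first_order \<phi>" and \<sigma>: "range \<sigma> \<subseteq> D"
    and C: "C = {a \<in> D. sat D (\<sigma>(0 := a)) (\<lambda>_. {}) \<phi>}"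
    using assms unfolding first_order_definable_def by blast
  obtain s where s: "s \<in> D" "rep s \<sigma>" using rep_exists \<sigma> by blast
  define nd :: "fm \<Rightarrow> 'v" where "nd \<psi> = ordn (node_number \<psi>)" for \<psi>
  define F where "F = nd ` {\<psi>. first_order \<psi>}"
  define T where "T = {pair (nd \<psi>) t | \<psi> t \<tau>.
    first_order \<psi> \<and> t \<in> D \<and> rep t \<tau> \<and> sat D \<tau> (\<lambda>_. {}) \<psi>}"
  have T: "pair (nd \<psi>) t \<in> T \<longleftrightarrow> sat D \<tau> (\<lambda>_. {}) \<psi>"
    if "first_order \<psi>" "t \<in> D" "rep t \<tau>" for \<psi> t \<tau>
  proof
    assume "pair (nd \<psi>) t \<in> T"
    then obtain \<psi>' \<tau>' where "first_order \<psi>'" "rep t \<tau>'" "sat D \<tau>' (\<lambda>_. {}) \<psi>'" "nd \<psi> = nd \<psi>'"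
      unfolding T_def by auto
    then show "sat D \<tau> (\<lambda>_. {}) \<psi>"
      using that node_number_inject rep_unique unfolding nd_def ordn_eq by metis
  qed (use that T_def in blast)
  have sub: "nd \<psi> \<in> elts (nd \<chi>)" if "node_number \<psi> < node_number \<chi>" for \<psi> \<chi>
    using that unfolding nd_def by (simp add: elts_ordn)
  have "node F T (nd \<psi>)" if \<psi>: "first_order \<psi>" for \<psi>
  proof (cases \<psi>)
    case (FMem x y)
    then have "\<forall>s\<in>D. \<forall>\<sigma>. rep s \<sigma> \<longrightarrow> (pair (nd \<psi>) s \<in> T \<longleftrightarrow> \<sigma> x \<in> elts (\<sigma> y))"
      using T[OF \<psi>] by simp
    then show ?thesis unfolding node_def by blast
  next
    case (FEq x y)
    then have "\<forall>s\<in>D. \<forall>\<sigma>. rep s \<sigma> \<longrightarrow> (pair (nd \<psi>) s \<in> T \<longleftrightarrow> \<sigma> x = \<sigma> y)"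
      using T[OF \<psi>] by simp
    then show ?thesis unfolding node_def by blast
  next
    case (FNeg \<chi>)
    then have "nd \<chi> \<in> elts (nd \<psi>) \<inter> F" "first_order \<chi>"
      using \<psi> sub[OF node_number_less(1)] unfolding F_def by auto
    moreover from this have "\<forall>s\<in>D. \<forall>\<sigma>. rep s \<sigma> \<longrightarrow> (pair (nd \<psi>) s \<in> T \<longleftrightarrow> pair (nd \<chi>) s \<notin> T)"
      using FNeg T[OF \<psi>] T by simp
    ultimately show ?thesis unfolding node_def by blast
  next
    case (FAnd \<chi> \<chi>')
    then have "nd \<chi> \<in> elts (nd \<psi>) \<inter> F" "first_order \<chi>"
      "nd \<chi>' \<in> elts (nd \<psi>) \<inter> F" "first_order \<chi>'"
      using \<psi> sub[OF node_number_less(2)] sub[OF node_number_less(3)] unfolding F_def by auto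
    moreover from this have "\<forall>s\<in>D. \<forall>\<sigma>. rep s \<sigma> \<longrightarrow>
        (pair (nd \<psi>) s \<in> T \<longleftrightarrow> pair (nd \<chi>) s \<in> T \<and> pair (nd \<chi>') s \<in> T)"
      using FAnd T[OF \<psi>] T by simp
    ultimately show ?thesis unfolding node_def by blast
  next
    case (FAll x \<chi>)
    then have \<chi>: "nd \<chi> \<in> elts (nd \<psi>) \<inter> F" "first_order \<chi>"
      using \<psi> sub[OF node_number_less(4)] unfolding F_def by auto
    have "pair (nd \<psi>) s \<in> T \<longleftrightarrow> (\<forall>a\<in>D. \<forall>t\<in>D. rep t (\<sigma>(x := a)) \<longrightarrow> pair (nd \<chi>) t \<in> T)"
      if s: "s \<in> D" "rep s \<sigma>" for s \<sigma>
    proof -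
      have "(\<forall>t\<in>D. rep t (\<sigma>(x := a)) \<longrightarrow> pair (nd \<chi>) t \<in> T) \<longleftrightarrow> sat D (\<sigma>(x := a)) (\<lambda>_. {}) \<chi>"
        if a: "a \<in> D" for a
      proof -
        have "(\<sigma>(x := a)) m \<in> D" for m using rep_range[OF s] a by simp
        then obtain t where "t \<in> D" "rep t (\<sigma>(x := a))" using rep_exists by blast
        then show ?thesis using T[OF \<chi>(2)] by blast
      qed
      then show ?thesis using FAll T[OF \<psi> s] by simp
    qed
    then show ?thesis using \<chi>(1) unfolding node_def by blast
  qed (use \<psi> in auto)
  then have "\<forall>d\<in>F. node F T d" unfolding F_def by blast
  moreover have "nd \<phi> \<in> F" unfolding F_def using \<phi> by blast
  moreover have "(\<forall>t\<in>D. rep t (\<sigma>(0 := a)) \<longrightarrow> pair (nd \<phi>) t \<in> T) \<longleftrightarrow>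
      sat D (\<sigma>(0 := a)) (\<lambda>_. {}) \<phi>" if a: "a \<in> D" for a
  proof -
    have "(\<sigma>(0 := a)) m \<in> D" for m using rep_range[OF s] a by simp
    then obtain t where "t \<in> D" "rep t (\<sigma>(0 := a))" using rep_exists by blast
    then show ?thesis using T[OF \<phi>] by blast
  qed
  ultimately have "coded C F T (nd \<phi>) s" unfolding coded_def C using s(2) by blast
  moreover have "F \<subseteq> D" "nd \<phi> \<in> D" unfolding F_def nd_def using D_ordn by blast+
  moreover have "T \<subseteq> D" unfolding T_def nd_def using D_ordn D_pair by blast
  ultimately show ?thesis using s(1) by blast
qed

text \<open>No range condition on \<open>s\<close> and \<open>S\<close>: under \<open>fm_rel\<close>
  the sentence is evaluated in a smaller rank, at assignments whose values need not lie in
  it.\<close>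

lemma sat_definably_mahlo: "sat D s S fm_definably_mahlo \<longleftrightarrow> definably_mahlo \<kappa>"
proof -
  let ?R = "\<lambda>C. club C \<kappa> \<longrightarrow> (\<exists>\<mu>\<in>C. regular_cardinal \<mu>)"
  have "sat D s S fm_definably_mahlo \<longleftrightarrow>
    (\<forall>C\<subseteq>D. \<forall>F\<subseteq>D. \<forall>T\<subseteq>D. \<forall>w\<in>D. \<forall>c\<in>D. \<forall>r\<in>D. w = omega \<and> coded C F T c r \<longrightarrow> ?R C)"
    unfolding fm_definably_mahlo_def sat_simps
    by (simp add: sat_coded sat_club_regular)
  also have "\<dots> \<longleftrightarrow> (\<forall>C\<subseteq>D. first_order_definable D C \<longrightarrow> ?R C)" (is "?l \<longleftrightarrow> ?r")
  proof
    assume l: ?l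
    show ?r
    proof (intro allI impI)
      fix C assume C: "C \<subseteq> D" "first_order_definable D C" "club C \<kappa>"
      then obtain F T c r where c: "F \<subseteq> D" "T \<subseteq> D" "c \<in> D" "r \<in> D" "coded C F T c r"
        using definable_imp_coded[OF C(2)] by blast
      show "\<exists>\<mu>\<in>C. regular_cardinal \<mu>"
        using l[rule_format, OF C(1) c(1,2) D_omega c(3,4) conjI[OF refl c(5)] C(3)] .
    qed
  next
    assume ?r
    then show ?l using coded_imp_definable by blast
  qed
  also have "\<dots> \<longleftrightarrow> definably_mahlo \<kappa>"
  proof -
    have "C \<subseteq> D" if "first_order_definable D C" for C
      using that unfolding first_order_definable_def by blast
    then show ?thesis unfolding definably_mahlo_def using card_kappa by blast
  qed
  finally show ?thesis .
qed

end

subsection \<open>Categoricity\<close>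

text \<open>Variable \<open>1\<close> is \<mu>, and variable \<open>0\<close> is V_\<mu>, placed
  where \<open>fm_rel\<close> expects its domain.\<close>

definition fm_none_below :: fm where
  "fm_none_below = FAll 1 (FAll 0 (FImp
     (FAnd (fm_inaccessible 1) (FAll 2 (FIff (FMem 2 0) (fm_in_Vset 2 1))))
     (FNeg (fm_rel fm_definably_mahlo))))"

lemma first_order_none_below: "first_order fm_none_below"
  unfolding fm_none_below_def by (simp add: first_order_rel fm_defs connective_defs)

context inaccessible_rank
begin

lemma sat_none_below:
  "sat D s S fm_none_below \<longleftrightarrow> (\<forall>\<mu>\<in>elts \<kappa>. \<not> (inaccessible \<mu> \<and> definably_mahlo \<mu>))"
proof -
  have inacc: "inaccessible a \<Longrightarrow> a \<in> D \<Longrightarrow> a \<in> elts \<kappa>" for a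
    unfolding inaccessible_def regular_cardinal_def cardinal_def using D_ord by blast
  have rank: "sat D (s(1 := \<mu>, 0 := v)) S
      (FAnd (fm_inaccessible 1) (FAll 2 (FIff (FMem 2 0) (fm_in_Vset 2 1)))) \<longleftrightarrow>
    inaccessible \<mu> \<and> elts v = Vset \<mu>" if "\<mu> \<in> D" "v \<in> D" for \<mu> v
  \<comment> \<open>\<open>sat_in_Vset\<close> requires an ordinal as index, which inaccessibility
    of \<mu> provides.\<close>
  proof (cases "inaccessible \<mu>")
    case False
    then show ?thesis using that by (simp add: sat_inaccessible)
  next
    case True
    then have \<mu>: "\<mu> \<in> elts \<kappa>" using inacc that by blast
    have "(\<forall>a\<in>D. a \<in> elts v \<longleftrightarrow> a \<in> Vset \<mu>) \<longleftrightarrow> elts v = Vset \<mu>"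
      using D_trans[OF that(2)] Vset_mono[OF ordinal_mem_subset[OF ord \<mu>]] by blast
    then show ?thesis using that True \<mu> by (simp add: sat_inaccessible sat_in_Vset)
  qed
  have "sat D s S fm_none_below \<longleftrightarrow> (\<forall>\<mu>\<in>D. \<forall>v\<in>D. inaccessible \<mu> \<and> elts v = Vset \<mu> \<longrightarrow>
    \<not> sat D (s(1 := \<mu>, 0 := v)) S (fm_rel fm_definably_mahlo))"
    unfolding fm_none_below_def sat.simps(4,6) sat_connectives(1) using rank by blast
  also have "\<dots> \<longleftrightarrow> (\<forall>\<mu>\<in>D. \<forall>v\<in>D. inaccessible \<mu> \<and> elts v = Vset \<mu> \<longrightarrow> \<not> definably_mahlo \<mu>)"
  proof -
    have "sat D (s(1 := \<mu>, 0 := v)) S (fm_rel fm_definably_mahlo) \<longleftrightarrow> definably_mahlo \<mu>"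
      if "v \<in> D" "inaccessible \<mu>" "elts v = Vset \<mu>" for \<mu> v
      using that inaccessible_rank.sat_definably_mahlo[of \<mu>] by (simp add: sat_rel inaccessible_rank_def)
    then show ?thesis by blast
  qed
  also have "\<dots> \<longleftrightarrow> (\<forall>\<mu>\<in>elts \<kappa>. \<not> (inaccessible \<mu> \<and> definably_mahlo \<mu>))"
  proof -
    have "\<exists>v\<in>D. elts v = Vset \<mu>" if "\<mu> \<in> elts \<kappa>" for \<mu>
      using D_code small_Vset[OF that] Vset_mono[OF ordinal_mem_subset[OF ord that]] by blast
    then show ?thesis using inacc D_ord by blast
  qed
  finally show ?thesis .
qed

lemma models_iff:
  assumes "\<And>s S. sat D s S \<phi> \<longleftrightarrow> P"
  shows "models D \<phi> \<longleftrightarrow> P"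
proof
  obtain a where "a \<in> D" using D_nonempty by blast
  moreover assume "models D \<phi>"
  ultimately have "sat D (\<lambda>_. a) (\<lambda>_. {}) \<phi>" unfolding models_def by auto
  then show P using assms by simp
qed (simp add: models_def assms)

lemma models_none_below:
  "models D fm_none_below \<longleftrightarrow> (\<forall>\<mu>\<in>elts \<kappa>. \<not> (inaccessible \<mu> \<and> definably_mahlo \<mu>))"
  by (rule models_iff) (rule sat_none_below)

text \<open>The parameters of a definition are the free variables of \<phi>, over which
  \<open>models\<close> quantifies; one instance thus covers all classes that \<phi>
  defines.\<close>

lemma models_club_regular_inst:
  assumes "definably_mahlo \<kappa>" "first_order \<phi>" "0 < n" "free_vars \<phi> \<subseteq> {..<n}"
  shows "models D (fm_inst n \<phi> fm_club_regular)"
  unfolding models_def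
proof (intro allI impI)
  fix s :: "nat \<Rightarrow> 'v" and S :: "nat \<Rightarrow> 'v set" assume "range s \<subseteq> D \<and> range S \<subseteq> Pow D"
  then have s: "range s \<subseteq> D" by blast
  let ?C = "{a \<in> D. sat D (s(0 := a)) (\<lambda>_. {}) \<phi>}"
  have C: "?C = {a \<in> D. sat D (s(0 := a)) S \<phi>}"
    using sat_first_order[OF assms(2)] by blast
  have "first_order_definable D ?C" unfolding first_order_definable_def using s assms(2) by blast
  then have "club ?C \<kappa> \<longrightarrow> (\<exists>\<mu>\<in>?C. regular_cardinal \<mu>)"
    using assms(1) unfolding definably_mahlo_def by blast
  moreover have "no_class_quantifier fm_club_regular" by (simp add: fm_defs connective_defs)
  ultimately show "sat D s S (fm_inst n \<phi> fm_club_regular)"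
    using sat_inst[OF assms(3,4) _ s] sat_club_regular[of "\<lambda>_. ?C"] unfolding C by auto
qed

lemma definably_mahlo_if_models:
  assumes "\<And>\<phi> n. first_order \<phi> \<Longrightarrow> 0 < n \<Longrightarrow> free_vars \<phi> \<subseteq> {..<n} \<Longrightarrow>
    models D (fm_inst n \<phi> fm_club_regular)"
  shows "definably_mahlo \<kappa>"
  unfolding definably_mahlo_def
proof (intro conjI allI impI)
  fix C assume C: "club C \<kappa> \<and> first_order_definable D C"
  then obtain \<phi> s where \<phi>: "first_order \<phi>" and s: "range s \<subseteq> D"
    and C_def: "C = {a \<in> D. sat D (s(0 := a)) (\<lambda>_. {}) \<phi>}"
    unfolding first_order_definable_def by blast
  obtain n where n: "\<forall>x\<in>free_vars \<phi>. x < n"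
    using finite_free_vars(1)[of \<phi>] finite_nat_set_iff_bounded by blast
  \<comment> \<open>\<open>Suc n\<close> because the shift must be positive even if \<phi> has no
    free variables.\<close>
  then have *: "0 < Suc n" "free_vars \<phi> \<subseteq> {..<Suc n}" by auto
  have "sat D s (\<lambda>_. {}) (fm_inst (Suc n) \<phi> fm_club_regular)"
    using assms[OF \<phi> *] s unfolding models_def by auto
  moreover have "no_class_quantifier fm_club_regular" by (simp add: fm_defs connective_defs)
  ultimately have "sat D (\<lambda>i. s (i + Suc n)) (\<lambda>_. C) fm_club_regular"
    using sat_inst[OF * _ s] unfolding C_def by blast
  then show "\<exists>\<mu>\<in>C. regular_cardinal \<mu>"
    using C sat_club_regular[of "\<lambda>_. C"] unfolding C_def by auto
qed (rule card_kappa)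

end

lemma inaccessible_trichotomy:
  assumes "inaccessible \<kappa>" "inaccessible \<mu>"
  shows "\<mu> \<in> elts \<kappa> \<or> \<mu> = \<kappa> \<or> \<kappa> \<in> elts \<mu>"
  using ordinal_trichotomy[of \<mu> \<kappa>] assms
  by (simp add: inaccessible_def regular_cardinal_def cardinal_def)

lemma least_second_order_categorical:
  fixes \<kappa> :: "'v::zfc"
  assumes \<kappa>: "inaccessible \<kappa>" "definably_mahlo \<kappa>"
    and least: "\<And>\<mu>. \<mu> \<in> elts \<kappa> \<Longrightarrow> \<not> (inaccessible \<mu> \<and> definably_mahlo \<mu>)"
  shows "sententially_categorical second_order_sentences \<kappa>"
proof -
  let ?\<sigma> = "sentence_of (FAnd fm_definably_mahlo fm_none_below)"
  have \<sigma>: "models (Vset \<mu>) ?\<sigma> \<longleftrightarrow>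
      definably_mahlo \<mu> \<and> (\<forall>\<nu>\<in>elts \<mu>. \<not> (inaccessible \<nu> \<and> definably_mahlo \<nu>))"
    if "inaccessible \<mu>" for \<mu> :: 'v
  proof -
    interpret inaccessible_rank \<mu> using that by unfold_locales
    show ?thesis unfolding models_sentence_of
      by (rule models_iff) (simp add: sat_definably_mahlo sat_none_below)
  qed
  show ?thesis
    unfolding sententially_categorical_def
    using sentence_of_second_order \<sigma> \<kappa> least inaccessible_trichotomy by blast
qed

text \<open>The theory is the full first-order theory of V_\<kappa>. Through the scheme and
  \<open>fm_none_below\<close> it makes any other model V_\<mu> come from a least definably Mahlo
  \<mu> as well, against trichotomy.\<close>

lemma least_theory_categorical:
  fixes \<kappa> :: "'v::zfc"
  assumes \<kappa>: "inaccessible \<kappa>" "definably_mahlo \<kappa>"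
    and least: "\<And>\<mu>. \<mu> \<in> elts \<kappa> \<Longrightarrow> \<not> (inaccessible \<mu> \<and> definably_mahlo \<mu>)"
  shows "theory_categorical first_order_sentences \<kappa>"
  unfolding theory_categorical_def
proof (intro conjI exI[of _ "{\<sigma> \<in> first_order_sentences. models (Vset \<kappa>) \<sigma>}"] allI impI notI)
  fix \<mu> :: 'v
  assume \<mu>: "inaccessible \<mu> \<and> \<mu> \<noteq> \<kappa>"
    and T: "\<forall>\<sigma>\<in>{\<sigma> \<in> first_order_sentences. models (Vset \<kappa>) \<sigma>}. models (Vset \<mu>) \<sigma>"
  interpret K: inaccessible_rank \<kappa> using \<kappa>(1) by unfold_locales
  interpret M: inaccessible_rank \<mu> using \<mu> by unfold_locales blast
  have transfer: "models (Vset \<kappa>) \<phi> \<Longrightarrow> models (Vset \<mu>) \<phi>" if "first_order \<phi>" for \<phi>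
    using T sentence_of_first_order[OF that] models_sentence_of by blast
  have "definably_mahlo \<mu>"
    using M.definably_mahlo_if_models transfer[OF first_order_inst]
      K.models_club_regular_inst[OF \<kappa>(2)] by blast
  moreover have "\<forall>\<nu>\<in>elts \<mu>. \<not> (inaccessible \<nu> \<and> definably_mahlo \<nu>)"
    using transfer[OF first_order_none_below] M.models_none_below K.models_none_below least by blast
  ultimately show False using \<mu> \<kappa> least inaccessible_trichotomy by blast
qed (use \<kappa> in auto)

subsection \<open>Reflection\<close>

primrec fm_alls :: "fm \<Rightarrow> (nat \<times> fm) list" where
  "fm_alls (FMem x y) = []"
| "fm_alls (FEq x y) = []"
| "fm_alls (FIn x X) = []"
| "fm_alls (FNeg \<phi>) = fm_alls \<phi>"
| "fm_alls (FAnd \<phi> \<psi>) = fm_alls \<phi> @ fm_alls \<psi>"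
| "fm_alls (FAll x \<phi>) = (x, \<phi>) # fm_alls \<phi>"
| "fm_alls (FAll2 X \<phi>) = []"

lemma first_order_alls: "first_order \<phi> \<Longrightarrow> (x, \<psi>) \<in> set (fm_alls \<phi>) \<Longrightarrow> first_order \<psi>"
  by (induction \<phi>) auto

text \<open>The usual criterion in universal form: a quantified subformula without counterexample in
  \<open>E\<close> has none in \<open>D\<close>. Only the finitely many entries of
  \<open>fm_alls\<close> are tested, which keeps the condition expressible.\<close>

lemma Tarski_Vaught:
  assumes E: "E \<subseteq> D"
  shows "first_order \<phi> \<Longrightarrow>
    (\<And>x \<psi> s. (x, \<psi>) \<in> set (fm_alls \<phi>) \<Longrightarrow> range s \<subseteq> E \<Longrightarrow>
      \<forall>a\<in>E. sat D (s(x := a)) S \<psi> \<Longrightarrow> \<forall>a\<in>D. sat D (s(x := a)) S \<psi>) \<Longrightarrow>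
    range s \<subseteq> E \<Longrightarrow> sat E s S \<phi> \<longleftrightarrow> sat D s S \<phi>"
proof (induction \<phi> arbitrary: s)
  case (FAnd \<phi> \<psi>)
  have "sat E s S \<phi> \<longleftrightarrow> sat D s S \<phi>" by (rule FAnd.IH(1)) (use FAnd.prems in auto)
  moreover have "sat E s S \<psi> \<longleftrightarrow> sat D s S \<psi>" by (rule FAnd.IH(2)) (use FAnd.prems in auto)
  ultimately show ?case by simp
next
  case (FAll x \<phi>)
  have "sat E (s(x := a)) S \<phi> \<longleftrightarrow> sat D (s(x := a)) S \<phi>" if "a \<in> E" for a
    by (rule FAll.IH) (use FAll.prems that in auto)
  then have "sat E s S (FAll x \<phi>) \<longleftrightarrow> (\<forall>a\<in>E. sat D (s(x := a)) S \<phi>)" by simp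
  also have "\<dots> \<longleftrightarrow> sat D s S (FAll x \<phi>)"
  proof -
    have "(x, \<phi>) \<in> set (fm_alls (FAll x \<phi>))" by simp
    then show ?thesis using FAll.prems(2)[OF _ FAll.prems(3)] E unfolding sat.simps by blast
  qed
  finally show ?case .
next
  case (FNeg \<phi>)
  have "sat E s S \<phi> \<longleftrightarrow> sat D s S \<phi>" by (rule FNeg.IH) (use FNeg.prems in auto)
  then show ?case by simp
qed auto

definition fm_conj :: "fm list \<Rightarrow> fm" where
  "fm_conj \<phi>s = foldr FAnd \<phi>s (FEq 0 0)"

lemma sat_conj [simp]: "sat D s S (fm_conj \<phi>s) \<longleftrightarrow> (\<forall>\<phi>\<in>set \<phi>s. sat D s S \<phi>)"
  unfolding fm_conj_def by (induction \<phi>s) auto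

lemma first_order_conj [simp]: "first_order (fm_conj \<phi>s) \<longleftrightarrow> (\<forall>\<phi>\<in>set \<phi>s. first_order \<phi>)"
  unfolding fm_conj_def by (induction \<phi>s) auto

text \<open>In the formulas below, variables \<open>0\<close>, \<open>1\<close>, \<open>2\<close> stand for ordinals \<open>\<gamma>\<close>, \<open>\<beta>\<close>, \<open>\<delta>\<close>; those of the
  reflected formula are shifted by \<open>3\<close>.\<close>

definition fm_reflects :: "nat \<Rightarrow> fm \<Rightarrow> fm" where
  "fm_reflects x \<psi> = (let vs = sorted_list_of_set (free_vars (FAll x \<psi>)); \<psi>' = fm_inst 3 (FEq 0 0) \<psi> in
     foldr FAll (map (\<lambda>v. v + 3) vs) (FImp (fm_conj (map (\<lambda>v. fm_in_Vset (v + 3) 1) vs))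
       (FImp (FAll (x + 3) (FImp (fm_in_Vset (x + 3) 2) \<psi>')) (FAll (x + 3) \<psi>'))))"

definition fm_reflecting :: "fm \<Rightarrow> fm" where
  "fm_reflecting \<phi> = FAnd (fm_ordinal 0) (FBall 1 0 (FBex 2 0 (FAnd
     (FEx 3 (FAnd (fm_powerset 3 1) (fm_lepoll 3 2)))
     (FAnd (fm_infinite 2) (fm_conj (map (\<lambda>(x, \<psi>). fm_reflects x \<psi>) (fm_alls \<phi>)))))))"

lemma first_order_reflecting: "first_order \<phi> \<Longrightarrow> first_order (fm_reflecting \<phi>)"
  unfolding fm_reflecting_def fm_reflects_def Let_def
  by (auto simp: fm_defs connective_defs free_vars_foldr_FAll first_order_inst)

section \<open>The definable club of closure points\<close>

context inaccessible_rank
begin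

text \<open>Closed: a bound found below a smaller closure point is still available. Unbounded: a
  function that dominates the bounds is iterated \<omega> times, and the union stays below \<kappa>
  by uncountable cofinality.\<close>

lemma club_closure_points:
  assumes R: "\<And>\<beta>. \<beta> \<in> elts \<kappa> \<Longrightarrow> \<exists>\<delta>\<in>elts \<kappa>. R \<beta> \<delta>"
  shows "club {\<gamma> \<in> elts \<kappa>. \<forall>\<beta>\<in>elts \<gamma>. \<exists>\<delta>\<in>elts \<gamma>. R \<beta> \<delta>} \<kappa>" (is "club ?C \<kappa>")
  unfolding club_def
proof (intro conjI ballI impI)
  fix \<gamma> assume \<gamma>: "\<gamma> \<in> elts \<kappa>" "elts \<gamma> \<noteq> {} \<and> unbounded_in ?C \<gamma>"
  have "\<exists>\<delta>\<in>elts \<gamma>. R \<beta> \<delta>" if "\<beta> \<in> elts \<gamma>" for \<beta>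
  proof -
    have "unbounded_in ?C \<gamma>" using \<gamma>(2) ..
    from this[unfolded unbounded_in_def, rule_format, OF that]
    obtain \<gamma>' where \<gamma>': "\<gamma>' \<in> ?C \<inter> elts \<gamma>" "\<beta> \<in> elts \<gamma>'" by (rule bexE)
    then obtain \<delta> where "\<delta> \<in> elts \<gamma>'" "R \<beta> \<delta>" by auto
    moreover have "elts \<gamma>' \<subseteq> elts \<gamma>"
      using ordinal_mem_subset[OF ordinal_mem[OF ord \<gamma>(1)] IntD2[OF \<gamma>'(1)]] .
    ultimately show ?thesis by blast
  qed
  then show "\<gamma> \<in> ?C" using \<gamma>(1) by blast
next
  show "unbounded_in ?C \<kappa>"
    unfolding unbounded_in_def
  proof
    fix \<alpha> assume \<alpha>: "\<alpha> \<in> elts \<kappa>"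
    obtain f where f: "\<And>\<beta>. \<beta> \<in> elts \<kappa> \<Longrightarrow> f \<beta> \<in> elts \<kappa> \<and> R \<beta> (f \<beta>)" using R by metis
    have "\<exists>\<delta>\<in>elts \<kappa>. \<eta> \<in> elts \<delta> \<and> (\<forall>\<beta>\<in>elts \<eta>. f \<beta> \<in> elts \<delta>)" if \<eta>: "\<eta> \<in> elts \<kappa>" for \<eta>
    proof -
      obtain \<xi> where \<xi>: "\<xi> \<in> elts \<kappa>" "\<eta> \<in> elts \<xi>" using limit[OF \<eta>] by blast
      obtain \<zeta> where \<zeta>: "\<zeta> \<in> elts \<kappa>" "\<And>\<beta>. \<beta> \<in> elts \<eta> \<Longrightarrow> f \<beta> \<in> elts \<zeta>"
        using bounded_fun[OF small_elts[OF \<eta>], of f] f mem_trans[OF _ \<eta>] by blast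
      obtain \<delta> where \<delta>: "\<delta> \<in> elts \<kappa>" "{\<xi>, \<zeta>} \<subseteq> elts \<delta>"
        using bounded[of "{\<xi>, \<zeta>}"] small_finite[of "{\<xi>, \<zeta>}"] \<xi>(1) \<zeta>(1) by auto
      then have "elts \<xi> \<subseteq> elts \<delta>" "elts \<zeta> \<subseteq> elts \<delta>"
        using ordinal_mem_subset[OF ordinal_mem[OF ord \<delta>(1)]] by simp_all
      then show ?thesis using \<xi>(2) \<zeta>(2) \<delta>(1) by blast
    qed
    then obtain g where g: "\<And>\<eta>. \<eta> \<in> elts \<kappa> \<Longrightarrow>
        g \<eta> \<in> elts \<kappa> \<and> \<eta> \<in> elts (g \<eta>) \<and> (\<forall>\<beta>\<in>elts \<eta>. f \<beta> \<in> elts (g \<eta>))" by metis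
    \<comment> \<open>One application more than the index, so that \<alpha> is already an element of
      \<open>d 0\<close>.\<close>
    define d where "d n = (g ^^ Suc n) \<alpha>" for n
    have d0: "d 0 = g \<alpha>" and dS: "d (Suc n) = g (d n)" for n by (simp_all add: d_def)
    have d: "d n \<in> elts \<kappa>" for n by (induction n) (use \<alpha> g d0 dS in auto)
    obtain \<theta> where \<theta>: "\<theta> \<in> elts \<kappa>" "\<And>n. d n \<in> elts \<theta>"
      using bounded_fun[of UNIV d] d small_countable[of "UNIV :: nat set"] by auto
    have ord\<theta>: "ordinal \<theta>" using \<theta>(1) ord ordinal_mem by blast
    obtain \<gamma> where \<gamma>: "elts \<gamma> = {\<beta> \<in> elts \<theta>. \<exists>n. \<beta> \<in> elts (d n)}"
      using separation[of \<theta> "\<lambda>\<beta>. \<exists>n. \<beta> \<in> elts (d n)"] by auto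
    have mem: "\<beta> \<in> elts \<gamma> \<longleftrightarrow> (\<exists>n. \<beta> \<in> elts (d n))" for \<beta>
      using \<gamma> \<theta>(2) ordinal_mem_subset[OF ord\<theta>] by blast
    have "ordinal \<gamma>"
      unfolding ordinal_def transitive_set_def
    proof (intro conjI ballI)
      fix \<beta> assume \<beta>: "\<beta> \<in> elts \<gamma>"
      then obtain n where n: "\<beta> \<in> elts (d n)" using mem by blast
      have ordd: "ordinal (d n)" using d ord ordinal_mem by blast
      show "elts \<beta> \<subseteq> elts \<gamma>" using ordinal_mem_subset[OF ordd n] mem by blast
      fix \<eta> assume "\<eta> \<in> elts \<beta>"
      then show "elts \<eta> \<subseteq> elts \<beta>" using ordinal_mem_subset ordinal_mem[OF ordd n] by blast
    qed
    moreover have "elts \<gamma> \<subseteq> elts \<theta>" using \<gamma> by blast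
    ultimately have "\<gamma> \<in> elts \<kappa>"
      using ordinal_subset_mem[of \<gamma> \<theta>] ord\<theta> \<theta>(1) mem_trans by blast
    moreover have "\<exists>\<delta>\<in>elts \<gamma>. R \<beta> \<delta>" if \<beta>: "\<beta> \<in> elts \<gamma>" for \<beta>
    proof -
      obtain n where n: "\<beta> \<in> elts (d n)" using mem \<beta> by blast
      then have "f \<beta> \<in> elts (d (Suc n))" using g[OF d[of n]] dS by simp
      then show ?thesis using f[OF mem_trans[OF n d]] mem by blast
    qed
    moreover have "\<alpha> \<in> elts \<gamma>" using g[OF \<alpha>] d0 mem by metis
    ultimately show "\<exists>\<beta>\<in>?C \<inter> elts \<kappa>. \<alpha> \<in> elts \<beta>" by blast
  qed
qed blast

text \<open>Contrapositively: with parameters in V_\<beta>, a counterexample in V_\<kappa> yields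
  one in V_\<delta>. So \<delta> is a Skolem bound for \<beta>.\<close>

definition reflects :: "nat \<Rightarrow> fm \<Rightarrow> 'v \<Rightarrow> 'v \<Rightarrow> bool" where
  "reflects x \<psi> \<beta> \<delta> \<longleftrightarrow> (\<forall>t. range t \<subseteq> D \<longrightarrow> (\<forall>v\<in>free_vars (FAll x \<psi>). t v \<in> Vset \<beta>) \<longrightarrow>
     (\<forall>a\<in>Vset \<delta>. sat D (t(x := a)) (\<lambda>_. {}) \<psi>) \<longrightarrow> (\<forall>a\<in>D. sat D (t(x := a)) (\<lambda>_. {}) \<psi>))"

text \<open>For a cardinal closed under this relation, the first conjunct yields strong limitness,
  the second an infinite ordinal below it and so uncountability.\<close>

definition reflects_all :: "fm \<Rightarrow> 'v \<Rightarrow> 'v \<Rightarrow> bool" where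
  "reflects_all \<phi> \<beta> \<delta> \<longleftrightarrow> {y. elts y \<subseteq> elts \<beta>} \<lesssim> elts \<delta> \<and> infinite (elts \<delta>) \<and>
     (\<forall>(x, \<psi>)\<in>set (fm_alls \<phi>). reflects x \<psi> \<beta> \<delta>)"

lemma reflects_mono: "reflects x \<psi> \<beta> \<delta> \<Longrightarrow> elts \<delta> \<subseteq> elts \<delta>' \<Longrightarrow> reflects x \<psi> \<beta> \<delta>'"
  unfolding reflects_def using Vset_mono[of \<delta> \<delta>'] by (meson subsetD)

text \<open>For each assignment one rank catches a counterexample, if there is any. Only a small
  family of assignments matters, so regularity gives a common bound.\<close>

lemma reflects_exists:
  assumes \<beta>: "\<beta> \<in> elts \<kappa>"
  shows "\<exists>\<delta>\<in>elts \<kappa>. reflects x \<psi> \<beta> \<delta>"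
proof -
  \<comment> \<open>\<open>ordn 0\<close> is the default for variables that are not free in the
    formula; without it V_\<beta> could be empty and leave no assignment.\<close>
  let ?X = "insert (ordn 0) (Vset \<beta>)" and ?sat = "\<lambda>t a. sat D (t(x := a)) (\<lambda>_. {}) \<psi>"
  have X: "?X \<subseteq> D"
    using D_ordn[of 0] Vset_mono[OF ordinal_mem_subset[OF ord \<beta>]] by blast
  have "small ?X"
    using small_UN[of UNIV "\<lambda>b. if b then {ordn 0} else Vset \<beta>"] small_Vset[OF \<beta>]
      small_finite[of "UNIV :: bool set"] small_finite[of "{ordn 0 :: 'v}"]
    by (simp add: UNIV_bool)
  then have sm: "small {t :: nat \<Rightarrow> 'v. range t \<subseteq> ?X}" by (rule small_funs)
  \<comment> \<open>The rank of a counterexample gives \<delta>; if there is none, \<beta>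
    serves.\<close>
  have "\<exists>\<delta>\<in>elts \<kappa>. (\<forall>a\<in>Vset \<delta>. ?sat t a) \<longrightarrow> (\<forall>a\<in>D. ?sat t a)" for t
    using D_rank \<beta> by blast
  then obtain f where f: "\<And>t. f t \<in> elts \<kappa> \<and> ((\<forall>a\<in>Vset (f t). ?sat t a) \<longrightarrow> (\<forall>a\<in>D. ?sat t a))"
    by metis
  then obtain \<delta> where \<delta>: "\<delta> \<in> elts \<kappa>" "\<And>t. range t \<subseteq> ?X \<Longrightarrow> f t \<in> elts \<delta>"
    using bounded_fun[OF sm, of f] by blast
  have "reflects x \<psi> \<beta> \<delta>"
    unfolding reflects_def
  proof (intro allI impI)
    fix t :: "nat \<Rightarrow> 'v"
    assume t: "\<forall>v\<in>free_vars (FAll x \<psi>). t v \<in> Vset \<beta>" and all: "\<forall>a\<in>Vset \<delta>. ?sat t a"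
    define t' where "t' v = (if v \<in> free_vars (FAll x \<psi>) then t v else ordn 0)" for v
    have eq: "?sat t a \<longleftrightarrow> ?sat t' a" for a
      by (rule sat_cong) (auto simp: t'_def)
    have "range t' \<subseteq> ?X" using t unfolding t'_def by auto
    then have "Vset (f t') \<subseteq> Vset \<delta>"
      using \<delta> Vset_mono ordinal_mem_subset ordinal_mem[OF ord] by blast
    then show "\<forall>a\<in>D. ?sat t a" using all f[of t'] unfolding eq by blast
  qed
  then show ?thesis using \<delta>(1) by blast
qed

lemma reflects_all_exists:
  assumes \<beta>: "\<beta> \<in> elts \<kappa>"
  shows "\<exists>\<delta>\<in>elts \<kappa>. reflects_all \<phi> \<beta> \<delta>"
proof -
  obtain f where f: "\<And>x \<psi>. f (x, \<psi>) \<in> elts \<kappa> \<and> reflects x \<psi> \<beta> (f (x, \<psi>))"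
  proof -
    have "\<forall>p. \<exists>\<delta>. \<delta> \<in> elts \<kappa> \<and> reflects (fst p) (snd p) \<beta> \<delta>" using reflects_exists[OF \<beta>] by blast
    then obtain f where "\<forall>p. f p \<in> elts \<kappa> \<and> reflects (fst p) (snd p) \<beta> (f p)" by metis
    then show thesis by (intro that[of f]) auto
  qed
  obtain \<delta>1 where \<delta>1: "\<delta>1 \<in> elts \<kappa>" "{y. elts y \<subseteq> elts \<beta>} \<lesssim> elts \<delta>1"
    using small_iff small_elts_subset[OF small_elts[OF \<beta>]] by blast
  obtain \<delta>2 where \<delta>2: "\<delta>2 \<in> elts \<kappa>" "(UNIV :: nat set) \<lesssim> elts \<delta>2"
    using small_iff[of "UNIV :: nat set"] small_countable[of "UNIV :: nat set"] by auto
  let ?I = "insert \<delta>1 (insert \<delta>2 (f ` set (fm_alls \<phi>)))"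
  have "?I \<subseteq> elts \<kappa>" using \<delta>1 \<delta>2 f by auto
  moreover have "small ?I" by (rule small_finite) simp
  ultimately obtain \<delta> where \<delta>: "\<delta> \<in> elts \<kappa>" "?I \<subseteq> elts \<delta>" using bounded by blast
  have sub: "\<xi> \<in> ?I \<Longrightarrow> elts \<xi> \<subseteq> elts \<delta>" for \<xi>
    using \<delta> ordinal_mem_subset[OF ordinal_mem[OF ord]] by blast
  have "{y. elts y \<subseteq> elts \<beta>} \<lesssim> elts \<delta>"
    using \<delta>1(2) subset_imp_lepoll[OF sub[of \<delta>1]] lepoll_trans by blast
  moreover have "infinite (elts \<delta>)"
    unfolding infinite_le_lepoll using \<delta>2(2) subset_imp_lepoll[OF sub[of \<delta>2]] lepoll_trans by blast
  moreover have "reflects x \<psi> \<beta> \<delta>" if "(x, \<psi>) \<in> set (fm_alls \<phi>)" for x \<psi>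
    using f reflects_mono sub[of "f (x, \<psi>)"] that by blast
  ultimately show ?thesis unfolding reflects_all_def using \<delta>(1) by blast
qed

text \<open>\<open>fm_inst\<close> acts here as a renaming of variables: \<psi> is first-order, and
  \<open>FEq 0 0\<close> merely fills the slot for a class formula.\<close>

lemma sat_reflects:
  assumes \<psi>: "first_order \<psi>" and s: "range s \<subseteq> D" "s 1 \<in> elts \<kappa>" "s 2 \<in> elts \<kappa>"
  shows "sat D s S (fm_reflects x \<psi>) \<longleftrightarrow> reflects x \<psi> (s 1) (s 2)"
proof -
  let ?fv = "free_vars (FAll x \<psi>)" and ?V = "(\<lambda>v. v + 3) ` free_vars (FAll x \<psi>)"
  let ?sat = "\<lambda>t a. sat D (t(x := a)) (\<lambda>_. {}) \<psi>"
  have inst: "sat D (t(x + 3 := a)) S (fm_inst 3 (FEq 0 0) \<psi>) \<longleftrightarrow> ?sat (\<lambda>i. t (i + 3)) a"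
    if t: "range t \<subseteq> D" "a \<in> D" for t a
  proof -
    have "range (t(x + 3 := a)) \<subseteq> D" using t by auto
    moreover have "(\<lambda>i. (t(x + 3 := a)) (i + 3)) = (\<lambda>i. t (i + 3))(x := a)" by (rule ext) simp
    ultimately have "sat D (t(x + 3 := a)) S (fm_inst 3 (FEq 0 0) \<psi>) \<longleftrightarrow>
      sat D ((\<lambda>i. t (i + 3))(x := a)) (\<lambda>_. {b \<in> D. sat D (t(x + 3 := a, 0 := b)) S (FEq 0 0)}) \<psi>"
      using sat_inst[where n = 3 and \<phi> = "FEq 0 0" and \<psi> = \<psi> and s = "t(x + 3 := a)" and S = S]
        first_order_no_class_quantifier[OF \<psi>]
      by (simp del: fun_upd_apply sat.simps)
    then show ?thesis using sat_first_order[OF \<psi>] by blast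
  qed
  have body: "sat D t S (FImp (fm_conj (map (\<lambda>v. fm_in_Vset (v + 3) 1) (sorted_list_of_set ?fv)))
       (FImp (FAll (x + 3) (FImp (fm_in_Vset (x + 3) 2) (fm_inst 3 (FEq 0 0) \<psi>)))
         (FAll (x + 3) (fm_inst 3 (FEq 0 0) \<psi>)))) \<longleftrightarrow>
    ((\<forall>v\<in>?fv. t (v + 3) \<in> Vset (s 1)) \<longrightarrow> (\<forall>a\<in>Vset (s 2). ?sat (\<lambda>i. t (i + 3)) a) \<longrightarrow>
      (\<forall>a\<in>D. ?sat (\<lambda>i. t (i + 3)) a))"
    if t: "range t \<subseteq> D" "t 1 = s 1" "t 2 = s 2" for t
  proof -
    have "t v \<in> D" for v using t by blast
    moreover have "(\<forall>a\<in>D. a \<in> Vset (s 2) \<longrightarrow> P a) \<longleftrightarrow> (\<forall>a\<in>Vset (s 2). P a)" for P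
      using Vset_mono[OF ordinal_mem_subset[OF ord s(3)]] by blast
    moreover have "sat D (t(x + 3 := a)) S (fm_in_Vset (x + 3) 2) \<longleftrightarrow> a \<in> Vset (s 2)" if "a \<in> D" for a
      using sat_in_Vset[of "t(x + 3 := a)" "x + 3" 2] t s that by simp
    ultimately show ?thesis
      using s t inst[OF t(1)] finite_free_vars(1)[of "FAll x \<psi>"]
      by (simp add: sat_in_Vset del: fun_upd_apply free_vars.simps cong: ball_cong)
  qed
  have "sat D s S (fm_reflects x \<psi>) \<longleftrightarrow>
    (\<forall>t. (\<forall>y. y \<notin> ?V \<longrightarrow> t y = s y) \<and> (\<forall>y\<in>?V. t y \<in> D) \<longrightarrow>
      (\<forall>v\<in>?fv. t (v + 3) \<in> Vset (s 1)) \<longrightarrow> (\<forall>a\<in>Vset (s 2). ?sat (\<lambda>i. t (i + 3)) a) \<longrightarrow>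
      (\<forall>a\<in>D. ?sat (\<lambda>i. t (i + 3)) a))"
  proof -
    have t: "range t \<subseteq> D" "t 1 = s 1" "t 2 = s 2"
      if "(\<forall>y. y \<notin> ?V \<longrightarrow> t y = s y) \<and> (\<forall>y\<in>?V. t y \<in> D)" for t
    proof -
      have "t y \<in> D" for y using that s(1) by (cases "y \<in> ?V") auto
      then show "range t \<subseteq> D" by blast
      have "1 \<notin> ?V" "2 \<notin> ?V" by auto
      then show "t 1 = s 1" "t 2 = s 2" using that by blast+
    qed
    show ?thesis
      unfolding fm_reflects_def Let_def sat_foldr_FAll set_map
        set_sorted_list_of_set[OF finite_free_vars(1)]
      by (intro iff_allI imp_cong refl body) (erule t)+
  qed
  also have "\<dots> \<longleftrightarrow> reflects x \<psi> (s 1) (s 2)" (is "?l \<longleftrightarrow> _")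
  proof
    assume l: ?l
    show "reflects x \<psi> (s 1) (s 2)"
      unfolding reflects_def
    proof (intro allI impI)
      fix u assume u: "range u \<subseteq> D" "\<forall>v\<in>?fv. u v \<in> Vset (s 1)" "\<forall>a\<in>Vset (s 2). ?sat u a"
      \<comment> \<open>\<open>u\<close> is moved along the shift by 3; elsewhere \<open>s\<close>
        is kept, so that variables \<open>1\<close> and \<open>2\<close> still hold the two
        ordinals.\<close>
      define t where "t y = (if y \<in> ?V then u (y - 3) else s y)" for y
      have eq: "?sat (\<lambda>i. t (i + 3)) a \<longleftrightarrow> ?sat u a" for a
        by (rule sat_cong) (auto simp: t_def)
      have "\<forall>y. y \<notin> ?V \<longrightarrow> t y = s y" "\<forall>y\<in>?V. t y \<in> D" "\<forall>v\<in>?fv. t (v + 3) \<in> Vset (s 1)"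
        using u unfolding t_def by auto
      then show "\<forall>a\<in>D. ?sat u a" using l u(3) unfolding eq[symmetric] by blast
    qed
  next
    assume r: "reflects x \<psi> (s 1) (s 2)"
    show ?l
    proof (intro allI impI)
      fix t assume t: "(\<forall>y. y \<notin> ?V \<longrightarrow> t y = s y) \<and> (\<forall>y\<in>?V. t y \<in> D)"
        "\<forall>v\<in>?fv. t (v + 3) \<in> Vset (s 1)" "\<forall>a\<in>Vset (s 2). ?sat (\<lambda>i. t (i + 3)) a"
      have "t y \<in> D" for y using t(1) s(1) by (cases "y \<in> ?V") auto
      then have "range (\<lambda>i. t (i + 3)) \<subseteq> D" by blast
      then show "\<forall>a\<in>D. ?sat (\<lambda>i. t (i + 3)) a"
        using r t(2,3) unfolding reflects_def by blast
    qed
  qed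
  finally show ?thesis .
qed

lemma sat_reflecting:
  assumes \<phi>: "first_order \<phi>" and s: "range s \<subseteq> D"
  shows "sat D s S (fm_reflecting \<phi>) \<longleftrightarrow>
    s 0 \<in> elts \<kappa> \<and> (\<forall>\<beta>\<in>elts (s 0). \<exists>\<delta>\<in>elts (s 0). reflects_all \<phi> \<beta> \<delta>)"
proof (cases "ordinal (s 0)")
  case False
  have "s 0 \<in> D" using s by blast
  then show ?thesis using False D_ord[of "s 0"] by (simp add: fm_reflecting_def sat_ordinal)
next
  case True
  have s0: "s 0 \<in> D" using s by blast
  then have \<gamma>: "s 0 \<in> elts \<kappa>" using True D_ord by blast
  have mem: "\<beta> \<in> elts \<kappa>" if "\<beta> \<in> elts (s 0)" for \<beta> using that \<gamma> mem_trans by blast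
  have refl: "sat D (s(1 := \<beta>, 2 := \<delta>)) S (fm_reflects x \<psi>) \<longleftrightarrow> reflects x \<psi> \<beta> \<delta>"
    if "\<beta> \<in> elts (s 0)" "\<delta> \<in> elts (s 0)" "(x, \<psi>) \<in> set (fm_alls \<phi>)" for \<beta> \<delta> x \<psi>
  proof -
    have "range (s(1 := \<beta>, 2 := \<delta>)) \<subseteq> D" using s that s0 D_trans by auto
    then show ?thesis
      using sat_reflects[OF first_order_alls[OF \<phi> that(3)], of "s(1 := \<beta>, 2 := \<delta>)"] mem that by simp
  qed
  have pow: "(\<exists>p\<in>D. elts p = {y. elts y \<subseteq> elts \<beta>} \<and> elts p \<lesssim> elts \<delta>) \<longleftrightarrow>
    {y. elts y \<subseteq> elts \<beta>} \<lesssim> elts \<delta>" if "\<beta> \<in> D" for \<beta> \<delta>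
  proof -
    from D_Pow[OF that] obtain p where "p \<in> D" "elts p = {y. elts y \<subseteq> elts \<beta>}" by blast
    then show ?thesis by metis
  qed
  define B where "B = FAnd (FEx 3 (FAnd (fm_powerset 3 1) (fm_lepoll 3 2)))
      (FAnd (fm_infinite 2) (fm_conj (map (\<lambda>(x, \<psi>). fm_reflects x \<psi>) (fm_alls \<phi>))))"
  have B: "sat D (s(1 := \<beta>, 2 := \<delta>)) S B \<longleftrightarrow> reflects_all \<phi> \<beta> \<delta>" if "\<beta> \<in> elts (s 0)" "\<delta> \<in> elts (s 0)" for \<beta> \<delta>
  proof -
    have D: "\<beta> \<in> D" "\<delta> \<in> D" using that s0 D_trans by blast+
    have "sat D (s(1 := \<beta>, 2 := \<delta>)) S (FEx 3 (FAnd (fm_powerset 3 1) (fm_lepoll 3 2))) \<longleftrightarrow>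
      {y. elts y \<subseteq> elts \<beta>} \<lesssim> elts \<delta>"
      using D by (simp add: sat_powerset sat_lepoll pow)
    moreover have "sat D (s(1 := \<beta>, 2 := \<delta>)) S (fm_infinite 2) \<longleftrightarrow> infinite (elts \<delta>)"
      using D by (simp add: sat_infinite)
    moreover have "sat D (s(1 := \<beta>, 2 := \<delta>)) S
        (fm_conj (map (\<lambda>(x, \<psi>). fm_reflects x \<psi>) (fm_alls \<phi>))) \<longleftrightarrow>
      (\<forall>(x, \<psi>)\<in>set (fm_alls \<phi>). reflects x \<psi> \<beta> \<delta>)"
      using refl[OF that] by (auto simp del: fun_upd_apply)
    ultimately show ?thesis unfolding B_def reflects_all_def sat.simps(5) by blast
  qed
  have "sat D s S (fm_reflecting \<phi>) \<longleftrightarrow> (\<forall>\<beta>\<in>D. \<beta> \<in> elts (s 0) \<longrightarrow>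
      (\<exists>\<delta>\<in>D. \<delta> \<in> elts (s 0) \<and> sat D (s(1 := \<beta>, 2 := \<delta>)) S B))"
    unfolding fm_reflecting_def B_def[symmetric] using True s0 by (simp add: sat_ordinal)
  also have "\<dots> \<longleftrightarrow> (\<forall>\<beta>\<in>elts (s 0). \<exists>\<delta>\<in>elts (s 0). reflects_all \<phi> \<beta> \<delta>)"
    using B D_trans[OF s0] by blast
  finally show ?thesis using \<gamma> by blast
qed

end

section \<open>Failure of first-order sentential categoricity\<close>

lemma not_first_order_categorical:
  fixes \<kappa> :: "'v::zfc"
  assumes \<kappa>: "inaccessible \<kappa>" "definably_mahlo \<kappa>"
  shows "\<not> sententially_categorical first_order_sentences \<kappa>"
proof
  assume "sententially_categorical first_order_sentences \<kappa>"
  then obtain \<sigma> where \<sigma>: "first_order \<sigma>" "models (Vset \<kappa>) \<sigma>"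
    and unique: "\<And>\<mu>. inaccessible \<mu> \<Longrightarrow> \<mu> \<noteq> \<kappa> \<Longrightarrow> \<not> models (Vset \<mu>) \<sigma>"
    unfolding sententially_categorical_def first_order_sentences_def by blast
  interpret K: inaccessible_rank \<kappa> using \<kappa>(1) by unfold_locales
  let ?C = "{\<gamma> \<in> elts \<kappa>. \<forall>\<beta>\<in>elts \<gamma>. \<exists>\<delta>\<in>elts \<gamma>. K.reflects_all \<sigma> \<beta> \<delta>}"
  have "first_order_definable (Vset \<kappa>) ?C"
    unfolding first_order_definable_def
  proof (intro exI conjI)
    \<comment> \<open>By \<open>sat_reflecting\<close> only the value of variable \<open>0\<close>
      counts, so any assignment into V_\<kappa> will do.\<close>
    let ?s = "\<lambda>_. ordn 0 :: 'v"
    show "first_order (fm_reflecting \<sigma>)" using first_order_reflecting[OF \<sigma>(1)] .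
    show "range ?s \<subseteq> Vset \<kappa>" using K.D_ordn[of 0] by auto
    have "sat (Vset \<kappa>) (?s(0 := a)) (\<lambda>_. {}) (fm_reflecting \<sigma>) \<longleftrightarrow> a \<in> ?C" if "a \<in> Vset \<kappa>" for a
    proof -
      have "range (?s(0 := a)) \<subseteq> Vset \<kappa>" using that K.D_ordn[of 0] by auto
      from K.sat_reflecting[OF \<sigma>(1) this] show ?thesis by simp
    qed
    moreover have "?C \<subseteq> Vset \<kappa>" using K.D_ord by blast
    ultimately show "?C = {a \<in> Vset \<kappa>. sat (Vset \<kappa>) (?s(0 := a)) (\<lambda>_. {}) (fm_reflecting \<sigma>)}"
      by blast
  qed
  moreover have "club ?C \<kappa>" by (rule K.club_closure_points) (rule K.reflects_all_exists)
  ultimately obtain \<mu> where \<mu>: "\<mu> \<in> elts \<kappa>" "regular_cardinal \<mu>"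
    and step: "\<And>\<beta>. \<beta> \<in> elts \<mu> \<Longrightarrow> \<exists>\<delta>\<in>elts \<mu>. K.reflects_all \<sigma> \<beta> \<delta>"
    using \<kappa>(2) unfolding definably_mahlo_def by blast
  have card: "ordinal \<mu>" "infinite (elts \<mu>)" "\<And>\<delta>. \<delta> \<in> elts \<mu> \<Longrightarrow> \<not> elts \<delta> \<approx> elts \<mu>"
    using \<mu>(2) unfolding regular_cardinal_def cardinal_def by blast+
  have less: "elts \<delta> \<prec> elts \<mu>" if "\<delta> \<in> elts \<mu>" for \<delta>
    unfolding lesspoll_def
    using that card(3) subset_imp_lepoll[OF ordinal_mem_subset[OF card(1) that]] by blast
  have "uncountable (elts \<mu>)"
  proof -
    obtain \<beta> where "\<beta> \<in> elts \<mu>" using card(2) by fastforce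
    then obtain \<delta> where \<delta>: "\<delta> \<in> elts \<mu>" "infinite (elts \<delta>)"
      using step unfolding K.reflects_all_def by blast
    then show ?thesis
      using less[OF \<delta>(1)] ordinal_mem_subset[OF card(1) \<delta>(1)]
      unfolding uncountable_iff_lesspoll by blast
  qed
  moreover have "strong_limit \<mu>"
    unfolding strong_limit_def
  proof
    fix \<alpha> assume "\<alpha> \<in> elts \<mu>"
    then obtain \<delta> where \<delta>: "\<delta> \<in> elts \<mu>" "{y. elts y \<subseteq> elts \<alpha>} \<lesssim> elts \<delta>"
      using step unfolding K.reflects_all_def by blast
    have "Pow (elts \<alpha>) \<lesssim> elts \<delta>"
      using eqpoll_sym[OF elts_subset_eqpoll_Pow] \<delta>(2) by (rule lepoll_trans1)
    then show "Pow (elts \<alpha>) \<prec> elts \<mu>" using less[OF \<delta>(1)] by (rule lesspoll_trans1)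
  qed
  ultimately have inacc: "inaccessible \<mu>" unfolding inaccessible_def using \<mu>(2) by blast
  interpret M: inaccessible_rank \<mu> using inacc by unfold_locales
  have sub: "Vset \<mu> \<subseteq> Vset \<kappa>" using Vset_mono[OF ordinal_mem_subset[OF K.ord \<mu>(1)]] .
  have TV: "\<forall>a\<in>Vset \<kappa>. sat (Vset \<kappa>) (s(x := a)) (\<lambda>_. {}) \<psi>"
    if x: "(x, \<psi>) \<in> set (fm_alls \<sigma>)" and s: "range s \<subseteq> Vset \<mu>"
      and all: "\<forall>a\<in>Vset \<mu>. sat (Vset \<kappa>) (s(x := a)) (\<lambda>_. {}) \<psi>" for x \<psi> s
  proof -
    \<comment> \<open>A formula has finitely many parameters, so their ranks have a bound \<beta>
      below \<mu>, and closure of \<mu> supplies the Skolem bound \<delta>.\<close>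
    have "s ` free_vars (FAll x \<psi>) \<subseteq> Vset \<mu>" using s by blast
    moreover have "finite (s ` free_vars (FAll x \<psi>))"
      using finite_free_vars(1)[of "FAll x \<psi>"] by (rule finite_imageI)
    ultimately obtain \<beta> where \<beta>: "\<beta> \<in> elts \<mu>" "s ` free_vars (FAll x \<psi>) \<subseteq> Vset \<beta>"
      using M.D_bounded[OF _ M.small_finite] by blast
    from step[OF \<beta>(1)] obtain \<delta> where \<delta>: "\<delta> \<in> elts \<mu>" "K.reflects_all \<sigma> \<beta> \<delta>" by blast
    then have refl: "K.reflects x \<psi> \<beta> \<delta>" using x unfolding K.reflects_all_def by auto
    have "Vset \<delta> \<subseteq> Vset \<mu>" using Vset_mono[OF ordinal_mem_subset[OF card(1) \<delta>(1)]] .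
    then have "\<forall>a\<in>Vset \<delta>. sat (Vset \<kappa>) (s(x := a)) (\<lambda>_. {}) \<psi>" using all by blast
    moreover have "range s \<subseteq> Vset \<kappa>" using s sub by blast
    moreover have "\<forall>v\<in>free_vars (FAll x \<psi>). s v \<in> Vset \<beta>" using \<beta>(2) by blast
    ultimately show ?thesis using refl unfolding K.reflects_def by simp
  qed
  have "models (Vset \<mu>) \<sigma>"
    unfolding models_def
  proof (intro allI impI)
    fix s :: "nat \<Rightarrow> 'v" and S :: "nat \<Rightarrow> 'v set"
    assume s: "range s \<subseteq> Vset \<mu> \<and> range S \<subseteq> Pow (Vset \<mu>)"
    then have "sat (Vset \<kappa>) s (\<lambda>_. {}) \<sigma>" using \<sigma>(2) sub unfolding models_def by auto
    then have "sat (Vset \<mu>) s (\<lambda>_. {}) \<sigma>"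
      using Tarski_Vaught[OF sub \<sigma>(1) TV] s by blast
    then show "sat (Vset \<mu>) s S \<sigma>" using sat_first_order[OF \<sigma>(1)] by blast
  qed
  then show False using unique[OF inacc] \<mu>(1) mem_irrefl by blast
qed

theorem theorem32:
  fixes \<kappa> :: "'v::zfc"
  assumes "inaccessible \<kappa>"
    and "definably_mahlo \<kappa>"
    and "\<And>\<mu>. \<mu> \<in> elts \<kappa> \<Longrightarrow> \<not> (inaccessible \<mu> \<and> definably_mahlo \<mu>)"
  shows "sententially_categorical second_order_sentences \<kappa> \<and>
    theory_categorical first_order_sentences \<kappa> \<and>
    \<not> sententially_categorical first_order_sentences \<kappa>"
  using least_second_order_categorical[OF assms] least_theory_categorical[OF assms]
    not_first_order_categorical[OF assms(1,2)] by blast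

end
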